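(* There exist constants $C_1>0$ and $\nu_1\ge\nu_0$, each depending only on $\mu_1,\mu_2,\max_{i,j}\|a_{ij}\|_{C^1(\overline{Q}_T)},Q_T,\overline{C}$, such that the following holds. Let $\delta_0\in(0,1)$ be so small that $$\ln\left[\left(\ln(\delta_0^{-1/3})\right)^{1/\ln(T+1)}\right]\ge\nu_1 ,$$ let $\delta\in(0,\delta_0)$ and $M>0$, and let $u_1,u_2\in H^2(Q_T)$ be two functions satisfying, for $i=1,2$, $$\partial_t u_i=Lu_i+F(\nabla u_i,u_i,x,t)\ \text{ in } Q_T,\qquad u_i|_{S_T}=0,\qquad u_i(x,T)=g_i(x),\ x\in\Omega .$$ Suppose that $f=g_1-g_2$ satisfies $\|f\|_{L_2(\Omega)}\le\delta$ and that $\|\nabla u_i(x,0)\|_{L_2(\Omega)}\le M$ for $i=1,2$. Then $w=u_1-u_2$ satisfies, for any $\tau\in(0,T)$, $$\|w\|_{H^{1,0}(Q_{T\tau})}\le C_1(M+1)\exp\left[-\frac{1}{3^{c}}\left(\ln(\delta^{-1})\right)^{c}\right],\qquad c=c(\tau,T)=\frac{\ln(\tau+1)}{\ln(T+1)}\in(0,1).$$ The constant $C_1$ is independent of $M$.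
   Context: All functions are real valued. $\Omega\subset\mathbb{R}^n$ is a bounded domain with piecewise smooth boundary $\partial\Omega$, $T>0$, $Q_T=\Omega\times(0,T)$, $S_T=\partial\Omega\times(0,T)$, and $Q_{T\tau}=\Omega\times(\tau,T)$ for $\tau\in(0,T)$. $\nabla$ is the gradient in $x$ only. The functions $a_{ij}$, $i,j=1,\dots,n$, satisfy $a_{ij}=a_{ji}\in C^1(\overline{Q}_T)$ and, for constants $0<\mu_1\le\mu_2$, $\mu_1|\xi|^2\le\sum_{i,j=1}^n a_{ij}(x,t)\xi_i\xi_j\le\mu_2|\xi|^2$ for all $(x,t)\in\overline{Q}_T$, $\xi\in\mathbb{R}^n$. The operator $L$ is $Lu=\sum_{i,j=1}^n a_{ij}(x,t)u_{x_ix_j}$. The function $F\in C^1(\mathbb{R}^{2n+2})$ satisfies, with a constant $\overline{C}=\overline{C}(F)>0$, $|F(y_1)-F(y_2)|\le\overline{C}|y_1-y_2|$ for all $y_1,y_2\in\mathbb{R}^{2n+2}$; the argument of $F$ is $(\nabla u,u,x,t)$. For $\tau\in(0,T)$, $H^{1,0}(Q_{T\tau})$ is the space with norm $\|u\|_{H^{1,0}(Q_{T\tau})}=\left[\int_{Q_{T\tau}}\left((\nabla u)^2+u^2\right)(x,t)\,dx\,dt\right]^{1/2}$. $H^2(Q_T)$ is the Sobolev space over the $(n+1)$-dimensional domain $Q_T$; values at $t=0$, $t=T$ and on $S_T$ are traces. $\nu_0>1$ is a number depending only on $\mu_1,\mu_2,\max_{i,j}\|a_{ij}\|_{C^1(\overline{Q}_T)},Q_T$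 such that, with some $C>0$ depending only on the same parameters, for all $\nu\ge\nu_0$ and all $u\in H^2(Q_T)$ with $u|_{S_T}=0$ the following Carleman estimate holds: $$\int_{Q_T}(u_t-Lu)^2e^{2(t+1)^{\nu}}dx\,dt\ge C\sqrt{\nu}\int_{Q_T}(\nabla u)^2e^{2(t+1)^{\nu}}dx\,dt+C\nu^2\int_{Q_T}u^2e^{2(t+1)^{\nu}}dx\,dt-Ce^{3(T+1)^{\nu}}\|u(x,T)\|_{L_2(\Omega)}^2-C\|\nabla u(x,0)\|_{L_2(\Omega)}^2.$$ *)

theory Defs
  imports "HOL-Analysis.Analysis"
begin

section \<open>Classical differentiability classes\<close>

primrec Ck :: "nat \<Rightarrow> ('a::euclidean_space \<Rightarrow> real) \<Rightarrow> bool" where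
  "Ck 0 f \<longleftrightarrow> continuous_on UNIV f"
| "Ck (Suc k) f \<longleftrightarrow> (\<forall>x. f differentiable (at x)) \<and>
     (\<forall>b\<in>Basis. Ck k (\<lambda>x. frechet_derivative f (at x) b))"

text \<open>\<open>C\<^sup>1\<close> up to the boundary of an open set \<open>U\<close>: continuous on the closure, and the partial
  derivatives in \<open>U\<close> extend continuously to the closure.\<close>

definition C1_closure :: "'a::euclidean_space set \<Rightarrow> ('a \<Rightarrow> real) \<Rightarrow> bool" where
  "C1_closure U f \<longleftrightarrow> continuous_on (closure U) f \<and> (\<forall>x\<in>U. f differentiable (at x)) \<and>
     (\<forall>b\<in>Basis. \<exists>g. continuous_on (closure U) g \<and>
        (\<forall>x\<in>U. g x = frechet_derivative f (at x) b))"

text \<open>The suprema of the derivatives over \<open>U\<close> equal those of their continuous extensions over the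
  closure.\<close>

definition C1_norm :: "'a::euclidean_space set \<Rightarrow> ('a \<Rightarrow> real) \<Rightarrow> real" where
  "C1_norm U f = (SUP x\<in>closure U. \<bar>f x\<bar>) +
     (\<Sum>b\<in>Basis. SUP x\<in>U. \<bar>frechet_derivative f (at x) b\<bar>)"


section \<open>Hausdorff measure\<close>

text \<open>The normalised \<open>k\<close>-dimensional Hausdorff measure, i.e. the surface measure on
  \<open>k\<close>-dimensional (piecewise) smooth surfaces. The outer measure is a metric outer measure, hence
  countably additive on Borel sets, so that \<open>measure_of\<close> below does not degenerate to the
  zero measure.\<close>

definition hausdorff_pre :: "nat \<Rightarrow> real \<Rightarrow> 'a::metric_space set \<Rightarrow> ennreal" where
  "hausdorff_pre k d A =
     (INF C\<in>{C :: nat \<Rightarrow> 'a set. A \<subseteq> (\<Union>j. C j) \<and> (\<forall>j. bounded (C j) \<and> diameter (C j) \<le> d)}.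
        \<Sum>j. if C j = {} then 0 else ennreal (unit_ball_vol (real k) * (diameter (C j) / 2) ^ k))"

definition hausdorff_outer :: "nat \<Rightarrow> 'a::metric_space set \<Rightarrow> ennreal" where
  "hausdorff_outer k A = (SUP d\<in>{0<..}. hausdorff_pre k d A)"

definition hausdorff_measure :: "nat \<Rightarrow> 'a::metric_space measure" where
  "hausdorff_measure k = measure_of UNIV (sets borel) (hausdorff_outer k)"


section \<open>Domains with piecewise smooth boundary\<close>

text \<open>The boundary points near which the boundary is the hypersurface \<open>\<phi> = 0\<close>, with \<open>\<Omega>\<close> on the
  side \<open>\<phi> < 0\<close>.\<close>

definition smooth_part :: "'a::euclidean_space set \<Rightarrow> ('a \<Rightarrow> real) \<Rightarrow> 'a set" where
  "smooth_part \<Omega> \<phi> = {x \<in> frontier \<Omega>. \<phi> x = 0 \<and> (\<exists>b\<in>Basis. frechet_derivative \<phi> (at x) b \<noteq> 0) \<and>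
     (\<exists>e>0. \<Omega> \<inter> ball x e = {y \<in> ball x e. \<phi> y < 0})}"

text \<open>The boundary is a finite union of closed pieces of hypersurfaces, each hypersurface being
  regular up to the edge of its piece; the edges (where pieces meet) have zero
  \<open>(n - 1)\<close>-dimensional measure. Smooth is taken in the weakest usual sense,
  \<open>C\<^sup>1\<close>; no condition is imposed on the angles between pieces.\<close>

definition piecewise_smooth_boundary :: "'a::euclidean_space set \<Rightarrow> bool" where
  "piecewise_smooth_boundary \<Omega> \<longleftrightarrow>
     (\<exists>\<Phi>. finite \<Phi> \<and>
        (\<forall>\<phi>\<in>\<Phi>. Ck 1 \<phi> \<and>
           (\<forall>x\<in>closure (smooth_part \<Omega> \<phi>). \<exists>b\<in>Basis. frechet_derivative \<phi> (at x) b \<noteq> 0)) \<and>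
        frontier \<Omega> = (\<Union>\<phi>\<in>\<Phi>. closure (smooth_part \<Omega> \<phi>)) \<and>
        hausdorff_outer (DIM('a) - 1) (frontier \<Omega> - (\<Union>\<phi>\<in>\<Phi>. smooth_part \<Omega> \<phi>)) = 0)"


section \<open>Sobolev spaces and traces\<close>

definition square_integrable :: "'a measure \<Rightarrow> ('a \<Rightarrow> real) \<Rightarrow> bool" where
  "square_integrable M f \<longleftrightarrow> f \<in> borel_measurable M \<and> integrable M (\<lambda>x. (f x)\<^sup>2)"

definition L2norm :: "'a measure \<Rightarrow> ('a \<Rightarrow> 'b::real_normed_vector) \<Rightarrow> real" where
  "L2norm M f = sqrt (LINT x|M. (norm (f x))\<^sup>2)"

definition L2_tendsto :: "'a measure \<Rightarrow> (nat \<Rightarrow> 'a \<Rightarrow> real) \<Rightarrow> ('a \<Rightarrow> real) \<Rightarrow> bool" where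
  "L2_tendsto M f g \<longleftrightarrow> (\<lambda>k. \<integral>\<^sup>+x. ennreal ((f k x - g x)\<^sup>2) \<partial>M) \<longlonglongrightarrow> 0"

definition test_fun :: "'a::euclidean_space set \<Rightarrow> ('a \<Rightarrow> real) \<Rightarrow> bool" where
  "test_fun U \<phi> \<longleftrightarrow> (\<forall>k. Ck k \<phi>) \<and>
     compact (closure {x. \<phi> x \<noteq> 0}) \<and> closure {x. \<phi> x \<noteq> 0} \<subseteq> U"

definition loc_integrable :: "'a::euclidean_space set \<Rightarrow> ('a \<Rightarrow> real) \<Rightarrow> bool" where
  "loc_integrable U f \<longleftrightarrow> (\<forall>K. compact K \<and> K \<subseteq> U \<longrightarrow> integrable (lebesgue_on K) f)"

definition has_weak_partial ::
  "'a::euclidean_space set \<Rightarrow> 'a \<Rightarrow> ('a \<Rightarrow> real) \<Rightarrow> ('a \<Rightarrow> real) \<Rightarrow> bool" where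
  "has_weak_partial U b u v \<longleftrightarrow> loc_integrable U u \<and> loc_integrable U v \<and>
     (\<forall>\<phi>. test_fun U \<phi> \<longrightarrow>
        (LINT x|lebesgue_on U. u x * frechet_derivative \<phi> (at x) b) =
        - (LINT x|lebesgue_on U. v x * \<phi> x))"

text \<open>A representative of the weak derivative, which is unique up to null sets.\<close>

definition weak_partial :: "'a::euclidean_space set \<Rightarrow> 'a \<Rightarrow> ('a \<Rightarrow> real) \<Rightarrow> 'a \<Rightarrow> real" where
  "weak_partial U b u = (SOME v. has_weak_partial U b u v)"

text \<open>\<open>sobolev_H k U\<close> is \<open>H\<^sup>k(U)\<close>, with functions instead of classes modulo null sets.\<close>

primrec sobolev_H :: "nat \<Rightarrow> 'a::euclidean_space set \<Rightarrow> ('a \<Rightarrow> real) set" where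
  "sobolev_H 0 U = {u. square_integrable (lebesgue_on U) u}"
| "sobolev_H (Suc k) U = {u. square_integrable (lebesgue_on U) u \<and>
     (\<forall>b\<in>Basis. \<exists>v. has_weak_partial U b u v \<and> v \<in> sobolev_H k U)}"

text \<open>The trace operator as the \<open>H\<^sup>1(U) \<rightarrow> L\<^sub>2\<close> closure of the restriction of functions in
  \<open>C\<^sup>1\<close> up to the boundary. The part of the boundary is parametrised by \<open>\<iota>\<close>, with
  \<open>M\<close> the surface measure on the parameter space.\<close>

definition has_trace ::
  "'a::euclidean_space set \<Rightarrow> 'b measure \<Rightarrow> ('b \<Rightarrow> 'a) \<Rightarrow> ('a \<Rightarrow> real) \<Rightarrow> ('b \<Rightarrow> real) \<Rightarrow> bool" where
  "has_trace U M \<iota> u g \<longleftrightarrow> u \<in> sobolev_H 1 U \<and> square_integrable M g \<and>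
     (\<exists>v :: nat \<Rightarrow> 'a \<Rightarrow> real. (\<forall>k. C1_closure U (v k)) \<and>
        L2_tendsto (lebesgue_on U) v u \<and>
        (\<forall>b\<in>Basis. L2_tendsto (lebesgue_on U)
           (\<lambda>k x. frechet_derivative (v k) (at x) b) (weak_partial U b u)) \<and>
        L2_tendsto M (\<lambda>k y. v k (\<iota> y)) g)"


section \<open>The space-time cylinder and the parabolic operator\<close>

type_synonym 'n spacetime = "(real^'n) \<times> real"

text \<open>\<open>\<Omega> \<times> (s, T)\<close>; \<open>Q\<^sub>T\<close> is the case \<open>s = 0\<close>.\<close>

definition cyl :: "(real^'n) set \<Rightarrow> real \<Rightarrow> real \<Rightarrow> ('n::finite) spacetime set" where
  "cyl \<Omega> s T = \<Omega> \<times> {s<..<T}"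

definition dir_x :: "'n::finite \<Rightarrow> 'n spacetime" where
  "dir_x i = (axis i 1, 0)"

definition dir_t :: "('n::finite) spacetime" where
  "dir_t = (0, 1)"

definition Dt :: "('n::finite) spacetime set \<Rightarrow> ('n spacetime \<Rightarrow> real) \<Rightarrow> 'n spacetime \<Rightarrow> real" where
  "Dt Q u = weak_partial Q dir_t u"

definition grad_x ::
  "('n::finite) spacetime set \<Rightarrow> ('n spacetime \<Rightarrow> real) \<Rightarrow> 'n spacetime \<Rightarrow> real^'n" where
  "grad_x Q u z = (\<chi> i. weak_partial Q (dir_x i) u z)"

definition Lop ::
  "('n::finite \<Rightarrow> 'n \<Rightarrow> 'n spacetime \<Rightarrow> real) \<Rightarrow> 'n spacetime set \<Rightarrow>
     ('n spacetime \<Rightarrow> real) \<Rightarrow> 'n spacetime \<Rightarrow> real" where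
  "Lop a Q u z =
     (\<Sum>i\<in>UNIV. \<Sum>j\<in>UNIV. a i j z * weak_partial Q (dir_x j) (weak_partial Q (dir_x i) u) z)"

definition H10norm :: "('n::finite) spacetime set \<Rightarrow> ('n spacetime \<Rightarrow> real) \<Rightarrow> real" where
  "H10norm Q u = sqrt (LINT z|lebesgue_on Q. (norm (grad_x Q u z))\<^sup>2 + (u z)\<^sup>2)"

text \<open>\<open>u = 0\<close> on \<open>S\<^sub>T = \<partial>\<Omega> \<times> (0,T)\<close>, which has dimension \<open>n\<close>.\<close>

definition zero_lateral :: "(real^'n) set \<Rightarrow> real \<Rightarrow> (('n::finite) spacetime \<Rightarrow> real) \<Rightarrow> bool" where
  "zero_lateral \<Omega> T u \<longleftrightarrow>
     has_trace (cyl \<Omega> 0 T)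
       (restrict_space (hausdorff_measure CARD('n)) (frontier \<Omega> \<times> {0<..<T})) id u (\<lambda>_. 0)"

text \<open>\<open>u(x,s) = g(x)\<close> for \<open>x \<in> \<Omega>\<close>, where \<open>s = 0\<close> or \<open>s = T\<close>.\<close>

definition trace_at ::
  "(real^'n) set \<Rightarrow> real \<Rightarrow> real \<Rightarrow> (('n::finite) spacetime \<Rightarrow> real) \<Rightarrow> (real^'n \<Rightarrow> real) \<Rightarrow> bool" where
  "trace_at \<Omega> T s u g \<longleftrightarrow> has_trace (cyl \<Omega> 0 T) (lebesgue_on \<Omega>) (\<lambda>x. (x, s)) u g"

definition grad_trace_at ::
  "(real^'n) set \<Rightarrow> real \<Rightarrow> real \<Rightarrow> (('n::finite) spacetime \<Rightarrow> real) \<Rightarrow> (real^'n \<Rightarrow> real^'n) \<Rightarrow> bool" where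
  "grad_trace_at \<Omega> T s u h \<longleftrightarrow>
     (\<forall>i. trace_at \<Omega> T s (weak_partial (cyl \<Omega> 0 T) (dir_x i) u) (\<lambda>x. h x $ i))"

text \<open>Coefficient matrices with ellipticity constants \<open>\<mu>\<^sub>1\<close>, \<open>\<mu>\<^sub>2\<close> and largest \<open>C\<^sup>1\<close> norm
  exactly \<open>A\<close>. A constant quantified before \<open>a\<close> depends on \<open>a\<close> only through \<open>\<mu>\<^sub>1\<close>, \<open>\<mu>\<^sub>2\<close>, \<open>A\<close>.\<close>

definition coefficients ::
  "(real^'n) set \<Rightarrow> real \<Rightarrow> real \<Rightarrow> real \<Rightarrow> real \<Rightarrow> ('n::finite \<Rightarrow> 'n \<Rightarrow> 'n spacetime \<Rightarrow> real) \<Rightarrow> bool" where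
  "coefficients \<Omega> T \<mu>1 \<mu>2 A a \<longleftrightarrow>
     (\<forall>i j. C1_closure (cyl \<Omega> 0 T) (a i j)) \<and>
     (\<forall>i j. \<forall>z\<in>closure (cyl \<Omega> 0 T). a i j z = a j i z) \<and>
     (\<forall>z\<in>closure (cyl \<Omega> 0 T). \<forall>\<xi>::real^'n.
        \<mu>1 * (norm \<xi>)\<^sup>2 \<le> (\<Sum>i\<in>UNIV. \<Sum>j\<in>UNIV. a i j z * \<xi> $ i * \<xi> $ j) \<and>
        (\<Sum>i\<in>UNIV. \<Sum>j\<in>UNIV. a i j z * \<xi> $ i * \<xi> $ j) \<le> \<mu>2 * (norm \<xi>)\<^sup>2) \<and>
     (MAX (i, j)\<in>UNIV. C1_norm (cyl \<Omega> 0 T) (a i j)) = A"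

definition carleman_estimate ::
  "(real^'n) set \<Rightarrow> real \<Rightarrow> ('n::finite \<Rightarrow> 'n \<Rightarrow> 'n spacetime \<Rightarrow> real) \<Rightarrow> real \<Rightarrow> real \<Rightarrow> bool" where
  "carleman_estimate \<Omega> T a \<nu>0 C \<longleftrightarrow>
     (\<forall>\<nu>\<ge>\<nu>0. \<forall>u\<in>sobolev_H 2 (cyl \<Omega> 0 T). \<forall>g h.
        zero_lateral \<Omega> T u \<and> trace_at \<Omega> T T u g \<and> grad_trace_at \<Omega> T 0 u h \<longrightarrow>
        (LINT z|lebesgue_on (cyl \<Omega> 0 T).
           (Dt (cyl \<Omega> 0 T) u z - Lop a (cyl \<Omega> 0 T) u z)\<^sup>2 * exp (2 * (snd z + 1) powr \<nu>))
        \<ge> C * sqrt \<nu> * (LINT z|lebesgue_on (cyl \<Omega> 0 T).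
             (norm (grad_x (cyl \<Omega> 0 T) u z))\<^sup>2 * exp (2 * (snd z + 1) powr \<nu>))
          + C * \<nu>\<^sup>2 * (LINT z|lebesgue_on (cyl \<Omega> 0 T).
             (u z)\<^sup>2 * exp (2 * (snd z + 1) powr \<nu>))
          - C * exp (3 * (T + 1) powr \<nu>) * (L2norm (lebesgue_on \<Omega>) g)\<^sup>2
          - C * (L2norm (lebesgue_on \<Omega>) h)\<^sup>2)"

text \<open>\<open>u \<in> H\<^sup>2(Q\<^sub>T)\<close>, \<open>u\<^sub>t = Lu + F(\<nabla>u, u, x, t)\<close> almost everywhere in \<open>Q\<^sub>T\<close>, \<open>u = 0\<close> on \<open>S\<^sub>T\<close>
  and \<open>u(x,T) = g(x)\<close>.\<close>

definition solves_terminal_problem ::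
  "(real^'n) set \<Rightarrow> real \<Rightarrow> ('n::finite \<Rightarrow> 'n \<Rightarrow> 'n spacetime \<Rightarrow> real) \<Rightarrow>
     ((real^'n) \<times> real \<times> (real^'n) \<times> real \<Rightarrow> real) \<Rightarrow>
     (real^'n \<Rightarrow> real) \<Rightarrow> ('n spacetime \<Rightarrow> real) \<Rightarrow> bool" where
  "solves_terminal_problem \<Omega> T a F g u \<longleftrightarrow>
     u \<in> sobolev_H 2 (cyl \<Omega> 0 T) \<and>
     (AE z in lebesgue_on (cyl \<Omega> 0 T).
        Dt (cyl \<Omega> 0 T) u z =
        Lop a (cyl \<Omega> 0 T) u z + F (grad_x (cyl \<Omega> 0 T) u z, u z, fst z, snd z)) \<and>
     zero_lateral \<Omega> T u \<and> trace_at \<Omega> T T u g"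

end

theory Submission
  imports Defs
begin

text \<open>
  The difference \<open>w = u1 - u2\<close> satisfies \<open>w\<^sub>t - L w = F(\<nabla>u1, u1, x, t) - F(\<nabla>u2, u2, x, t)\<close>, so by
  the Lipschitz condition \<open>(w\<^sub>t - L w)\<^sup>2 \<le> Cbar\<^sup>2 (|\<nabla>w|\<^sup>2 + w\<^sup>2)\<close> almost everywhere. In the Carleman
  estimate for \<open>w\<close> the right-hand side grows with \<open>\<nu>\<close> at least like \<open>C sqrt \<nu>\<close>, so once
  \<open>C sqrt \<nu> \<ge> 2 Cbar\<^sup>2\<close> it absorbs this term, and the weighted energy of \<open>w\<close> is at most a
  multiple of \<open>exp (3 (T + 1)\<^sup>\<nu>) \<delta>\<^sup>2 + M\<^sup>2\<close> (\<open>weighted_energy_bound\<close>). The weight increases in time,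
  so on \<open>\<Omega> \<times> (\<tau>, T)\<close> it is at least \<open>exp (2 (\<tau> + 1)\<^sup>\<nu>)\<close>, which turns the bound into one for the
  \<open>H\<^sup>1\<^sup>,\<^sup>0\<close> norm (\<open>H10norm_subcylinder\<close>). The choice \<open>(T + 1)\<^sup>\<nu> = ln (1 / \<delta>) / 3\<close> balances the two
  terms: then \<open>exp (3 (T + 1)\<^sup>\<nu>) \<delta>\<^sup>2 = \<delta> < 1\<close>, while \<open>(\<tau> + 1)\<^sup>\<nu> = (ln (1 / \<delta>) / 3)\<^sup>c\<close> is exactly the
  exponent of the claim (\<open>optimal_carleman_parameter\<close>). The smallness of \<open>\<delta>0\<close> says that this \<open>\<nu>\<close>
  is admissible.

  The steps above treat weak derivatives and traces as linear, and compare weak derivatives on the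
  cylinder with those on the shorter cylinder. Since a weak derivative is a representative picked
  by a choice operator, both need that weak derivatives are unique up to null sets, that is, the
  fundamental lemma of the calculus of variations. It is obtained from explicit smooth bump
  functions which converge to the indicator of a box, together with Lebesgue differentiation.
\<close>

section \<open>Smooth bump functions on boxes\<close>

lemma frechet_derivative_eqI:
  "(f has_derivative f') (at x) \<Longrightarrow> frechet_derivative f (at x) = f'"
  by (metis frechet_derivative_at)

lemma Ck_SucI:
  assumes "\<And>x. (f has_derivative D x) (at x)" "\<And>b. b \<in> Basis \<Longrightarrow> Ck k (\<lambda>x. D x b)"
  shows "Ck (Suc k) f"
proof -
  have "frechet_derivative f (at x) = D x" for x
    using assms(1) by (rule frechet_derivative_eqI)
  then show ?thesis
    using assms by (auto simp: differentiable_def)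
qed

lemma Ck_Suc_has_derivative:
  "Ck (Suc k) f \<Longrightarrow> (f has_derivative frechet_derivative f (at x)) (at x)"
  by (simp add: frechet_derivative_works[symmetric])

lemma Ck_SucD: "Ck (Suc k) f \<Longrightarrow> Ck k f"
proof (induction k arbitrary: f)
  case 0
  then show ?case
    by (auto intro!: differentiable_imp_continuous_on simp: differentiable_on_def)
next
  case (Suc k)
  then show ?case by simp
qed

lemma Ck_const: "Ck k (\<lambda>x. c)"
  by (induction k arbitrary: c) auto

lemma Ck_add:
  assumes "Ck k f" "Ck k g" shows "Ck k (\<lambda>x. f x + g x)"
  using assms
proof (induction k arbitrary: f g)
  case 0
  then show ?case by (auto intro: continuous_intros)
next
  case (Suc k)
  have D: "((\<lambda>x. f x + g x) has_derivative
      (\<lambda>h. frechet_derivative f (at x) h + frechet_derivative g (at x) h)) (at x)" for x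
    using Suc.prems by (intro has_derivative_add Ck_Suc_has_derivative)
  show ?case
    by (rule Ck_SucI[OF D]) (use Suc in auto)
qed

lemma Ck_mult:
  assumes "Ck k f" "Ck k g" shows "Ck k (\<lambda>x. f x * g x)"
  using assms
proof (induction k arbitrary: f g)
  case 0
  then show ?case by (auto intro: continuous_intros)
next
  case (Suc k)
  have D: "((\<lambda>x. f x * g x) has_derivative
      (\<lambda>h. f x * frechet_derivative g (at x) h + frechet_derivative f (at x) h * g x)) (at x)" for x
    using Suc.prems by (intro has_derivative_mult Ck_Suc_has_derivative)
  show ?case
    by (rule Ck_SucI[OF D]) (use Suc Ck_SucD[OF Suc.prems(1)] Ck_SucD[OF Suc.prems(2)] in \<open>auto intro!: Ck_add\<close>)
qed

lemma Ck_prod: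
  assumes "finite I" "\<And>i. i \<in> I \<Longrightarrow> Ck k (f i)"
  shows "Ck k (\<lambda>x. \<Prod>i\<in>I. f i x)"
  using assms by (induction I rule: finite_induct) (auto intro: Ck_const Ck_mult)

text \<open>The whole sequence of successive derivatives is carried along, since differentiating in a
  direction only multiplies by a constant and moves to the next member of the sequence.\<close>

lemma Ck_ridge:
  fixes h :: "nat \<Rightarrow> real \<Rightarrow> real"
  assumes "\<And>n t. (h n has_real_derivative h (Suc n) t) (at t)"
  shows "Ck k (\<lambda>x. h n (x \<bullet> b + d))"
proof (induction k arbitrary: n)
  case 0
  have "continuous_on UNIV (h n)"
    using assms by (meson DERIV_isCont continuous_at_imp_continuous_on)
  then have "continuous_on UNIV (h n \<circ> (\<lambda>x. x \<bullet> b + d))"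
    by (intro continuous_on_compose) (auto intro!: continuous_intros elim: continuous_on_subset)
  then show ?case by (simp add: o_def)
next
  case (Suc k)
  have D: "((\<lambda>x. h n (x \<bullet> b + d)) has_derivative (\<lambda>v. h (Suc n) (x \<bullet> b + d) * (v \<bullet> b))) (at x)" for x
  proof -
    have "((\<lambda>x. x \<bullet> b + d) has_derivative (\<lambda>v. v \<bullet> b)) (at x)"
      by (auto intro!: derivative_eq_intros)
    from has_derivative_compose[OF this assms[of n, unfolded has_field_derivative_def]]
    show ?thesis by simp
  qed
  show ?case
    by (rule Ck_SucI[OF D]) (intro Ck_mult Suc.IH Ck_const)
qed

text \<open>The class of functions \<open>p(1/t) exp(-1/t)\<close>, extended by zero to \<open>t \<le> 0\<close>, is closed under
  differentiation. This makes the member with \<open>p = 1\<close> smooth.\<close>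

definition flat_exp :: "real poly \<Rightarrow> real \<Rightarrow> real" where
  "flat_exp p t = (if t > 0 then poly p (1 / t) * exp (- (1 / t)) else 0)"

lemma poly_times_exp_decay:
  "((\<lambda>s::real. poly p s * exp (- s)) \<longlongrightarrow> 0) at_top"
proof -
  have "((\<lambda>s::real. \<Sum>i\<le>degree p. coeff p i * (s ^ i / exp s)) \<longlongrightarrow> (\<Sum>i\<le>degree p. coeff p i * 0)) at_top"
    by (intro tendsto_intros tendsto_power_div_exp_0)
  then show ?thesis
    by (simp add: poly_altdef sum_distrib_right exp_minus divide_inverse mult.assoc)
qed

text \<open>For \<open>t > 0\<close> put \<open>s = 1/t\<close>: as \<open>ds/dt = - s\<^sup>2\<close>, the derivative of \<open>p(s) exp(-s)\<close> is
  \<open>s\<^sup>2 (p(s) - p'(s)) exp(-s)\<close>. At \<open>t = 0\<close> the difference quotient from the right is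
  \<open>s p(s) exp(-s)\<close>, which vanishes in the limit because \<open>exp\<close> beats every polynomial.\<close>

lemma flat_exp_has_derivative:
  "(flat_exp p has_real_derivative flat_exp ([:0, 0, 1:] * (p - pderiv p)) t) (at t)"
proof -
  consider "t > 0" | "t < 0" | "t = 0" by linarith
  then show ?thesis
  proof cases
    case 1
    have "((\<lambda>t. poly p (1 / t) * exp (- (1 / t))) has_real_derivative
        flat_exp ([:0, 0, 1:] * (p - pderiv p)) t) (at t)"
      using 1 by (auto intro!: derivative_eq_intros poly_DERIV[THEN DERIV_chain2]
          simp: flat_exp_def field_simps power2_eq_square)
    then show ?thesis
      by (rule has_field_derivative_transform_within_open[where S="{0<..}"])
        (use 1 in \<open>auto simp: flat_exp_def\<close>)
  next
    case 2
    have "((\<lambda>t. 0) has_real_derivative flat_exp ([:0, 0, 1:] * (p - pderiv p)) t) (at t)"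
      using 2 by (simp add: flat_exp_def)
    then show ?thesis
      by (rule has_field_derivative_transform_within_open[where S="{..<0}"])
        (use 2 in \<open>auto simp: flat_exp_def\<close>)
  next
    case 3
    have "((\<lambda>h. flat_exp p h / h) \<longlongrightarrow> 0) (at_right 0)"
    proof -
      have "((\<lambda>h. poly (pCons 0 p) (inverse h) * exp (- inverse h)) \<longlongrightarrow> 0) (at_right (0::real))"
        by (rule filterlim_compose[OF poly_times_exp_decay filterlim_inverse_at_top_right])
      moreover have "eventually (\<lambda>h. poly (pCons 0 p) (inverse h) * exp (- inverse h) = flat_exp p h / h) (at_right 0)"
        by (auto simp: eventually_at_right_field flat_exp_def field_simps intro!: exI[of _ 1])
      ultimately show ?thesis by (rule Lim_transform_eventually)
    qed
    moreover have "((\<lambda>h. flat_exp p h / h) \<longlongrightarrow> 0) (at_left 0)"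
      by (rule Lim_transform_eventually[OF tendsto_const])
        (auto simp: eventually_at_left_field flat_exp_def intro!: exI[of _ "-1"])
    ultimately show ?thesis
      using 3 by (simp add: DERIV_def filterlim_split_at flat_exp_def)
  qed
qed

text \<open>The scaling factor \<open>m + 1\<close> pushes every factor towards one inside the box as \<open>m\<close> grows, while all
  factors keep values in \<open>[0, 1]\<close> and the support stays in the closed box. The limit is therefore the
  indicator function of the open box, without any mollification or normalisation.\<close>

definition box_bump :: "nat \<Rightarrow> 'a::euclidean_space \<Rightarrow> 'a \<Rightarrow> 'a \<Rightarrow> real" where
  "box_bump m a b x =
     (\<Prod>i\<in>Basis. flat_exp 1 (real (Suc m) * ((x - a) \<bullet> i)) * flat_exp 1 (real (Suc m) * ((b - x) \<bullet> i)))"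

lemma flat_exp_1_nonneg: "0 \<le> flat_exp 1 t" and flat_exp_1_le: "flat_exp 1 t \<le> 1"
  by (auto simp: flat_exp_def)

lemma flat_exp_1_pos: "t > 0 \<Longrightarrow> flat_exp 1 t = exp (- (1 / t))"
  and flat_exp_1_0: "t \<le> 0 \<Longrightarrow> flat_exp 1 t = 0"
  by (auto simp: flat_exp_def)

lemma box_bump_nonneg: "0 \<le> box_bump m a b x"
  unfolding box_bump_def by (intro prod_nonneg) (simp add: flat_exp_1_nonneg)

lemma box_bump_le: "box_bump m a b x \<le> 1"
  unfolding box_bump_def
  by (intro prod_le_1) (simp add: flat_exp_1_nonneg flat_exp_1_le mult_le_one)

lemma Ck_flat_exp_affine: "Ck k (\<lambda>x. flat_exp p (x \<bullet> b + d))"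
proof -
  \<comment> \<open>The sequence of all derivatives of \<open>flat_exp p\<close>.\<close>
  define h where "h n = flat_exp (((\<lambda>p. [:0, 0, 1:] * (p - pderiv p)) ^^ n) p)" for n
  have "Ck k (\<lambda>x. h 0 (x \<bullet> b + d))"
    by (rule Ck_ridge) (simp only: h_def funpow.simps o_def flat_exp_has_derivative)
  then show ?thesis by (simp add: h_def)
qed

lemma Ck_box_bump: "Ck k (box_bump m a b)"
proof -
  have "Ck k (\<lambda>x. flat_exp 1 (x \<bullet> (real (Suc m) *\<^sub>R i) + (- real (Suc m) * (a \<bullet> i))) *
      flat_exp 1 (x \<bullet> (- real (Suc m) *\<^sub>R i) + real (Suc m) * (b \<bullet> i)))" for i
    by (intro Ck_mult Ck_flat_exp_affine)
  then have "Ck k (\<lambda>x. flat_exp 1 (real (Suc m) * ((x - a) \<bullet> i)) * flat_exp 1 (real (Suc m) * ((b - x) \<bullet> i)))" for i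
    by (simp only: inner_diff_left inner_scaleR_right right_diff_distrib
        add_uminus_conv_diff mult_minus_left) (simp add: algebra_simps)
  then have "Ck k (\<lambda>x. box_bump m a b x)"
    unfolding box_bump_def by (intro Ck_prod finite_Basis)
  then show ?thesis by simp
qed

lemma box_bump_outside: "x \<notin> box a b \<Longrightarrow> box_bump m a b x = 0"
proof -
  assume "x \<notin> box a b"
  then obtain i where i: "i \<in> Basis" "(x - a) \<bullet> i \<le> 0 \<or> (b - x) \<bullet> i \<le> 0"
    by (auto simp: mem_box inner_diff_left not_less)
  then have "flat_exp 1 (real (Suc m) * ((x - a) \<bullet> i)) * flat_exp 1 (real (Suc m) * ((b - x) \<bullet> i)) = 0"
    by (auto simp only: mult_eq_0_iff intro!: flat_exp_1_0 mult_nonneg_nonpos of_nat_0_le_iff)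
  then show ?thesis
    unfolding box_bump_def using i(1) by (intro prod_zero finite_Basis) blast
qed

lemma test_fun_box_bump:
  assumes "cbox a b \<subseteq> U"
  shows "test_fun U (box_bump m a b)"
proof -
  have sub: "{x. box_bump m a b x \<noteq> 0} \<subseteq> cbox a b"
    using box_bump_outside[of _ a b m] box_subset_cbox[of a b] by blast
  then have "closure {x. box_bump m a b x \<noteq> 0} \<subseteq> cbox a b"
    by (intro closure_minimal closed_cbox)
  moreover have "bounded {x. box_bump m a b x \<noteq> 0}"
    using sub bounded_cbox bounded_subset by blast
  ultimately show ?thesis
    using assms by (auto simp: test_fun_def Ck_box_bump)
qed

lemma box_bump_tendsto: "(\<lambda>m. box_bump m a b x) \<longlonglongrightarrow> indicator (box a b) x"
proof (cases "x \<in> box a b")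
  case True
  have lim: "(\<lambda>m. flat_exp 1 (real (Suc m) * t)) \<longlonglongrightarrow> 1" if "t > 0" for t
  proof -
    have "(\<lambda>m. exp (- (inverse (real (Suc m)) * (1 / t)))) \<longlonglongrightarrow> exp (- (0 * (1 / t)))"
      by (intro tendsto_intros LIMSEQ_inverse_real_of_nat)
    moreover have "exp (- (inverse (real (Suc m)) * (1 / t))) = flat_exp 1 (real (Suc m) * t)" for m
      using that by (subst flat_exp_1_pos) (auto simp del: of_nat_Suc simp: field_simps)
    ultimately show ?thesis by simp
  qed
  have "(\<lambda>m. box_bump m a b x) \<longlonglongrightarrow> (\<Prod>i\<in>(Basis::'a set). 1 * 1)"
    unfolding box_bump_def
    by (intro tendsto_prod tendsto_mult lim) (use True in \<open>auto simp: mem_box inner_diff_left\<close>)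
  then show ?thesis using True by simp
next
  case False
  then show ?thesis by (simp add: box_bump_outside)
qed


section \<open>The fundamental lemma of the calculus of variations\<close>

lemma borel_measurable_lebesgue_continuous:
  "continuous_on UNIV (f :: 'a::euclidean_space \<Rightarrow> real) \<Longrightarrow> f \<in> borel_measurable lebesgue"
  by (intro measurable_completion) (simp add: borel_measurable_continuous_onI)

lemma integrable_mult_compact_support:
  fixes f g :: "'a::euclidean_space \<Rightarrow> real"
  assumes U: "open U" and f: "loc_integrable U f" and g: "continuous_on UNIV g"
    and K: "compact K" "K \<subseteq> U" "\<And>x. x \<notin> K \<Longrightarrow> g x = 0"
  shows "integrable (lebesgue_on U) (\<lambda>x. f x * g x)"
proof -
  have "integrable (lebesgue_on K) f"
    using f K by (auto simp: loc_integrable_def)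
  then have f': "integrable lebesgue (\<lambda>x. indicator K x *\<^sub>R f x)"
    using K(1) by (subst (asm) integrable_restrict_space) (auto dest: compact_imp_closed)
  have "bounded (g ` K)"
    using compact_continuous_image[OF continuous_on_subset[OF g] K(1)] by (auto intro: compact_imp_bounded)
  then obtain B where B: "\<And>x. x \<in> K \<Longrightarrow> \<bar>g x\<bar> \<le> B"
    by (auto simp: bounded_iff)
  have eq: "indicator U x *\<^sub>R (f x * g x) = (indicator K x *\<^sub>R f x) * g x" for x
    using K by (auto simp: indicator_def)
  have "integrable lebesgue (\<lambda>x. (indicator K x *\<^sub>R f x) * g x)"
  proof (rule Bochner_Integration.integrable_bound)
    show "integrable lebesgue (\<lambda>x. B * (indicator K x *\<^sub>R f x))"
      using f' by simp
    show "(\<lambda>x. (indicator K x *\<^sub>R f x) * g x) \<in> borel_measurable lebesgue"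
      using f' borel_measurable_lebesgue_continuous[OF g] by measurable
    show "AE x in lebesgue. norm ((indicator K x *\<^sub>R f x) * g x) \<le> norm (B * (indicator K x *\<^sub>R f x))"
    proof (rule AE_I2)
      fix x
      have "\<bar>f x\<bar> * \<bar>g x\<bar> \<le> \<bar>B\<bar> * \<bar>f x\<bar>" if "x \<in> K"
        using B[OF that] by (subst mult.commute) (intro mult_right_mono, auto)
      then show "norm ((indicator K x *\<^sub>R f x) * g x) \<le> norm (B * (indicator K x *\<^sub>R f x))"
        by (auto simp: indicator_def abs_mult)
    qed
  qed
  moreover have "U \<inter> space lebesgue \<in> sets lebesgue"
    using U by auto
  ultimately show ?thesis
    by (simp only: integrable_restrict_space eq)
qed

text \<open>Testing with the bump functions of the box and passing to the limit by dominated convergence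
  gives the integral over the open box; the boundary of a box is a null set.\<close>

lemma integral_cbox_eq_0:
  fixes v :: "'a::euclidean_space \<Rightarrow> real"
  assumes U: "open U" and v: "loc_integrable U v"
    and test: "\<And>\<phi>. test_fun U \<phi> \<Longrightarrow> (LINT x|lebesgue_on U. v x * \<phi> x) = 0"
    and ab: "cbox a b \<subseteq> U"
  shows "(LINT x|lebesgue_on (cbox a b). v x) = 0"
proof -
  have "integrable (lebesgue_on (cbox a b)) v"
    using v ab by (auto simp: loc_integrable_def)
  then have int: "integrable lebesgue (\<lambda>x. indicator (cbox a b) x * v x)"
    by (subst (asm) integrable_restrict_space) auto
  then have m: "(\<lambda>x. indicator (cbox a b) x * v x) \<in> borel_measurable lebesgue"
    by auto
  have zero: "(LINT x|lebesgue. (indicator (cbox a b) x * v x) * box_bump m a b x) = 0" for m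
  proof -
    have eq: "indicator U x *\<^sub>R (v x * box_bump m a b x) = (indicator (cbox a b) x * v x) * box_bump m a b x" for x
      using ab box_bump_outside[of x a b m] box_subset_cbox[of a b] by (auto simp: indicator_def)
    have "U \<inter> space lebesgue \<in> sets lebesgue"
      using U by auto
    with test[OF test_fun_box_bump[OF ab, of m]] show ?thesis
      by (simp only: integral_restrict_space eq)
  qed
  have "(\<lambda>m. LINT x|lebesgue. (indicator (cbox a b) x * v x) * box_bump m a b x)
      \<longlonglongrightarrow> (LINT x|lebesgue. (indicator (cbox a b) x * v x) * indicator (box a b) x)"
  proof (rule integral_dominated_convergence)
    show "integrable lebesgue (\<lambda>x. norm (indicator (cbox a b) x * v x))"
      using int by (rule integrable_norm)
    have [measurable]: "box_bump m a b \<in> borel_measurable lebesgue" for m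
      using Ck_box_bump[of 0 m a b] by (intro borel_measurable_lebesgue_continuous) simp
    show "(\<lambda>x. (indicator (cbox a b) x * v x) * box_bump m a b x) \<in> borel_measurable lebesgue" for m
      using m by measurable
    show "(\<lambda>x. (indicator (cbox a b) x * v x) * indicator (box a b) x) \<in> borel_measurable lebesgue"
      by (intro borel_measurable_times[OF m] borel_measurable_indicator) auto
    show "AE x in lebesgue. (\<lambda>m. (indicator (cbox a b) x * v x) * box_bump m a b x)
        \<longlonglongrightarrow> (indicator (cbox a b) x * v x) * indicator (box a b) x"
      by (intro AE_I2 tendsto_mult tendsto_const box_bump_tendsto)
    show "AE x in lebesgue. norm ((indicator (cbox a b) x * v x) * box_bump m a b x)
        \<le> norm (indicator (cbox a b) x * v x)" for m
      using box_bump_nonneg[of m a b] box_bump_le[of m a b]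
      by (intro AE_I2) (auto simp: abs_mult intro!: mult_left_le)
  qed
  then have "(LINT x|lebesgue. (indicator (cbox a b) x * v x) * indicator (box a b) x) = 0"
    by (simp add: zero LIMSEQ_const_iff)
  moreover have "(LINT x|lebesgue. (indicator (cbox a b) x * v x) * indicator (box a b) x) =
      (LINT x|lebesgue. indicator (cbox a b) x * v x)"
  proof (rule integral_cong_AE)
    show "(\<lambda>x. indicator (cbox a b) x * v x) \<in> borel_measurable lebesgue"
      by (rule m)
    show "(\<lambda>x. (indicator (cbox a b) x * v x) * indicator (box a b) x) \<in> borel_measurable lebesgue"
      by (intro borel_measurable_times[OF m] borel_measurable_indicator) auto
    have "cbox a b - box a b \<in> null_sets lebesgue"
      using negligible_frontier_interval by (simp add: negligible_iff_null_sets)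
    then have "AE x in lebesgue. x \<notin> cbox a b - box a b"
      by (rule AE_not_in)
    then show "AE x in lebesgue. (indicator (cbox a b) x * v x) * indicator (box a b) x = indicator (cbox a b) x * v x"
      by eventually_elim (auto simp: indicator_def)
  qed
  ultimately show ?thesis
    by (subst integral_restrict_space) auto
qed

text \<open>All integrals of \<open>v\<close> over closed boxes in \<open>U\<close> vanish, and by Lebesgue differentiation \<open>v\<close> is almost
  everywhere a limit of such integrals divided by the volume of the box. Countably many closed boxes
  cover \<open>U\<close>.\<close>

lemma fundamental_lemma_calculus_of_variations:
  fixes v :: "'a::euclidean_space \<Rightarrow> real"
  assumes U: "open U" and v: "loc_integrable U v"
    and test: "\<And>\<phi>. test_fun U \<phi> \<Longrightarrow> (LINT x|lebesgue_on U. v x * \<phi> x) = 0"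
  shows "AE x in lebesgue_on U. v x = 0"
proof -
  have box: "AE x in lebesgue. x \<in> box c d \<longrightarrow> v x = 0" if cd: "cbox c d \<subseteq> U" for c d
  proof -
    \<comment> \<open>Extension by zero, so that the differentiation theorem applies to all boxes of the space.\<close>
    define f where "f x = (if x \<in> cbox c d then v x else 0)" for x
    have int: "integrable (lebesgue_on (cbox p q)) v" if "cbox p q \<subseteq> cbox c d" for p q
      using v that cd by (auto simp: loc_integrable_def)
    have f: "(f has_integral 0) (cbox p q)" for p q
    proof -
      obtain r s where rs: "cbox c d \<inter> cbox p q = cbox r s"
        by (rule that[OF Int_interval])
      then have sub: "cbox r s \<subseteq> cbox c d" by blast
      have "(v has_integral (LINT x|lebesgue_on (cbox r s). v x)) (cbox r s)"
        using int[OF sub] by (intro has_integral_integral_lebesgue_on) auto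
      then have "(v has_integral 0) (cbox r s)"
        using integral_cbox_eq_0[OF U v test] sub cd by simp
      then show ?thesis
        unfolding f_def has_integral_restrict_Int rs .
    qed
    obtain N where N: "negligible N"
      and lim: "\<And>x e. \<lbrakk>x \<notin> N; 0 < e\<rbrakk> \<Longrightarrow> \<exists>\<delta>>0. \<forall>h. 0 < h \<and> h < \<delta> \<longrightarrow>
        norm (integral (cbox x (x + h *\<^sub>R One)) f /\<^sub>R h ^ DIM('a) - f x) < e"
      using integrable_ccontinuous_explicit[of f] has_integral_integrable[OF f] by blast
    have "f x = 0" if "x \<notin> N" for x
    proof (rule ccontr)
      assume "f x \<noteq> 0"
      with lim[OF that, of "\<bar>f x\<bar>"] obtain \<delta> where "\<delta> > 0"
        and *: "\<And>h. 0 < h \<and> h < \<delta> \<Longrightarrow>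
          norm (integral (cbox x (x + h *\<^sub>R One)) f /\<^sub>R h ^ DIM('a) - f x) < \<bar>f x\<bar>"
        by auto
      show False
        using *[of "\<delta> / 2"] \<open>\<delta> > 0\<close> integral_unique[OF f] by simp
    qed
    moreover have "f x = v x" if "x \<in> box c d" for x
      using box_subset_cbox[of c d] that by (auto simp: f_def)
    moreover have "AE x in lebesgue. x \<notin> N"
      using N by (simp add: negligible_iff_null_sets AE_not_in)
    ultimately show ?thesis
      by (elim eventually_mono) metis
  qed
  obtain \<D> where D: "countable \<D>" "\<D> \<subseteq> Pow U" "\<And>X. X \<in> \<D> \<Longrightarrow> \<exists>a b. X = cbox a b" "\<Union>\<D> = U"
    using open_countable_Union_open_cbox[OF U] by blast
  have "AE x in lebesgue. x \<in> X \<longrightarrow> v x = 0" if X: "X \<in> \<D>" for X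
  proof -
    obtain c d where cd: "X = cbox c d" "cbox c d \<subseteq> U"
      using D X by blast
    have "AE x in lebesgue. x \<notin> cbox c d - box c d"
      using negligible_frontier_interval by (intro AE_not_in) (simp add: negligible_iff_null_sets)
    with box[OF cd(2)] show ?thesis
      unfolding cd(1) by eventually_elim auto
  qed
  then have "AE x in lebesgue. \<forall>X\<in>\<D>. x \<in> X \<longrightarrow> v x = 0"
    by (subst AE_ball_countable[OF D(1)]) blast
  then have "AE x in lebesgue. x \<in> U \<longrightarrow> v x = 0"
    by eventually_elim (use D(4) in blast)
  then show ?thesis
    using U by (subst AE_restrict_space_iff) auto
qed


section \<open>Calculus of weak derivatives\<close>

lemma test_fun_compact_support: "test_fun U \<phi> \<Longrightarrow> compact (closure {x. \<phi> x \<noteq> 0})"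
  and test_fun_support_subset: "test_fun U \<phi> \<Longrightarrow> closure {x. \<phi> x \<noteq> 0} \<subseteq> U"
  and test_fun_Ck: "test_fun U \<phi> \<Longrightarrow> Ck k \<phi>"
  by (auto simp: test_fun_def)

lemma test_fun_outside_support: "x \<notin> closure {x. \<phi> x \<noteq> (0::real)} \<Longrightarrow> \<phi> x = 0"
  using closure_subset[of "{x. \<phi> x \<noteq> 0}"] by auto

lemma partial_outside_support:
  fixes \<phi> :: "'a::euclidean_space \<Rightarrow> real"
  assumes "x \<notin> closure {x. \<phi> x \<noteq> 0}"
  shows "frechet_derivative \<phi> (at x) b = 0"
proof -
  have "(\<phi> has_derivative (\<lambda>_. 0)) (at x)"
  proof (rule has_derivative_transform_within_open)
    show "((\<lambda>_. 0) has_derivative (\<lambda>_. 0)) (at x)"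
      by (rule has_derivative_const)
    show "open (- closure {x. \<phi> x \<noteq> 0})"
      by (rule open_Compl[OF closed_closure])
    show "x \<in> - closure {x. \<phi> x \<noteq> 0}"
      using assms by (rule iffD2[OF Compl_iff])
    show "0 = \<phi> y" if "y \<in> - closure {x. \<phi> x \<noteq> 0}" for y
      using that test_fun_outside_support[of y \<phi>] by (simp only: Compl_iff simp_thms)
  qed
  then show ?thesis
    by (simp add: frechet_derivative_eqI)
qed

lemma integrable_mult_test_fun:
  assumes "open U" "loc_integrable U f" "test_fun U \<phi>"
  shows "integrable (lebesgue_on U) (\<lambda>x. f x * \<phi> x)"
proof (rule integrable_mult_compact_support[OF assms(1,2)])
  show "continuous_on UNIV \<phi>"
    using test_fun_Ck[OF assms(3), of 0] by simp
  show "compact (closure {x. \<phi> x \<noteq> 0})" "closure {x. \<phi> x \<noteq> 0} \<subseteq> U"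
    using assms(3) by (rule test_fun_compact_support, rule test_fun_support_subset)
  show "\<phi> x = 0" if "x \<notin> closure {x. \<phi> x \<noteq> 0}" for x
    using that by (rule test_fun_outside_support)
qed

lemma integrable_mult_partial_test_fun:
  assumes "open U" "loc_integrable U f" "test_fun U \<phi>" "b \<in> Basis"
  shows "integrable (lebesgue_on U) (\<lambda>x. f x * frechet_derivative \<phi> (at x) b)"
proof (rule integrable_mult_compact_support[OF assms(1,2)])
  show "continuous_on UNIV (\<lambda>x. frechet_derivative \<phi> (at x) b)"
    using test_fun_Ck[OF assms(3), of "Suc 0"] assms(4) by simp
  show "compact (closure {x. \<phi> x \<noteq> 0})" "closure {x. \<phi> x \<noteq> 0} \<subseteq> U"
    using assms(3) by (rule test_fun_compact_support, rule test_fun_support_subset)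
  show "frechet_derivative \<phi> (at x) b = 0" if "x \<notin> closure {x. \<phi> x \<noteq> 0}" for x
    using that by (rule partial_outside_support)
qed

lemma loc_integrable_diff:
  "loc_integrable U f \<Longrightarrow> loc_integrable U g \<Longrightarrow> loc_integrable U (\<lambda>x. f x - g x)"
  by (auto simp: loc_integrable_def)

lemma has_weak_partial_unique:
  assumes U: "open U" and "has_weak_partial U b u v" "has_weak_partial U b u v'"
  shows "AE x in lebesgue_on U. v x = v' x"
proof -
  have v: "loc_integrable U v" "loc_integrable U v'"
    using assms by (auto simp: has_weak_partial_def)
  have "(LINT x|lebesgue_on U. (v x - v' x) * \<phi> x) = 0" if \<phi>: "test_fun U \<phi>" for \<phi>
  proof -
    have "(LINT x|lebesgue_on U. v x * \<phi> x) = (LINT x|lebesgue_on U. v' x * \<phi> x)"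
      using assms(2,3) \<phi> unfolding has_weak_partial_def by (metis minus_equation_iff)
    then show ?thesis
      using integrable_mult_test_fun[OF U v(1) \<phi>] integrable_mult_test_fun[OF U v(2) \<phi>]
      by (simp add: left_diff_distrib)
  qed
  then have "AE x in lebesgue_on U. v x - v' x = 0"
    by (intro fundamental_lemma_calculus_of_variations U loc_integrable_diff v)
  then show ?thesis by simp
qed

lemma has_weak_partial_diff:
  assumes U: "open U" and b: "b \<in> Basis"
    and 1: "has_weak_partial U b u1 v1" and 2: "has_weak_partial U b u2 v2"
  shows "has_weak_partial U b (\<lambda>x. u1 x - u2 x) (\<lambda>x. v1 x - v2 x)"
proof -
  have loc: "loc_integrable U u1" "loc_integrable U u2" "loc_integrable U v1" "loc_integrable U v2"
    using 1 2 by (auto simp: has_weak_partial_def)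
  have "(LINT x|lebesgue_on U. (u1 x - u2 x) * frechet_derivative \<phi> (at x) b) =
      - (LINT x|lebesgue_on U. (v1 x - v2 x) * \<phi> x)" if \<phi>: "test_fun U \<phi>" for \<phi>
    using 1 2 \<phi> loc[THEN integrable_mult_partial_test_fun[OF U _ \<phi> b]]
      loc[THEN integrable_mult_test_fun[OF U _ \<phi>]]
    by (simp add: left_diff_distrib has_weak_partial_def)
  with loc show ?thesis
    by (simp add: has_weak_partial_def loc_integrable_diff)
qed

lemma has_weak_partial_cong_AE:
  assumes "AE x in lebesgue_on U. u x = u' x" "loc_integrable U u'" "open U" "b \<in> Basis"
    and 1: "has_weak_partial U b u v"
  shows "has_weak_partial U b u' v"
proof -
  have loc: "loc_integrable U u" "loc_integrable U v"
    using 1 by (auto simp: has_weak_partial_def)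
  have "(LINT x|lebesgue_on U. u' x * frechet_derivative \<phi> (at x) b) =
      (LINT x|lebesgue_on U. u x * frechet_derivative \<phi> (at x) b)" if \<phi>: "test_fun U \<phi>" for \<phi>
    by (intro integral_cong_AE borel_measurable_integrable integrable_mult_partial_test_fun assms loc \<phi>)
      (use assms(1) in auto)
  with assms show ?thesis
    by (simp add: has_weak_partial_def)
qed

lemma integral_lebesgue_on_superset:
  fixes f :: "'a::euclidean_space \<Rightarrow> real"
  assumes "open U" "open V" "V \<subseteq> U" "\<And>x. x \<notin> V \<Longrightarrow> f x = 0"
  shows "(LINT x|lebesgue_on V. f x) = (LINT x|lebesgue_on U. f x)"
proof -
  have "indicator V x *\<^sub>R f x = indicator U x *\<^sub>R f x" for x
    using assms by (auto simp: indicator_def)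
  moreover have "U \<inter> space lebesgue \<in> sets lebesgue" "V \<inter> space lebesgue \<in> sets lebesgue"
    using assms by auto
  ultimately show ?thesis
    by (simp only: integral_restrict_space)
qed

text \<open>A test function on the smaller set is one on the larger set, and it vanishes outside the
  smaller one together with its derivatives.\<close>

lemma has_weak_partial_subset:
  assumes "open U" "open V" "V \<subseteq> U" "has_weak_partial U b u v"
  shows "has_weak_partial V b u v"
proof -
  have "(LINT x|lebesgue_on V. u x * frechet_derivative \<phi> (at x) b) =
      - (LINT x|lebesgue_on V. v x * \<phi> x)" if \<phi>: "test_fun V \<phi>" for \<phi>
  proof -
    have "test_fun U \<phi>"
      using \<phi> assms by (auto simp: test_fun_def)
    moreover have "\<phi> x = 0" "frechet_derivative \<phi> (at x) b = 0" if "x \<notin> V" for x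
    proof -
      have "x \<notin> closure {x. \<phi> x \<noteq> 0}"
        using test_fun_support_subset[OF \<phi>] that by blast
      then show "\<phi> x = 0" "frechet_derivative \<phi> (at x) b = 0"
        by (rule test_fun_outside_support, rule partial_outside_support)
    qed
    ultimately show ?thesis
      using assms(4) integral_lebesgue_on_superset[OF assms(1-3)]
      by (simp add: has_weak_partial_def)
  qed
  then show ?thesis
    using assms by (auto simp: has_weak_partial_def loc_integrable_def)
qed

lemma has_weak_partial_weak_partial:
  "has_weak_partial U b u v \<Longrightarrow> has_weak_partial U b u (weak_partial U b u)"
  unfolding weak_partial_def by (rule someI[of "has_weak_partial U b u"])

lemma weak_partial_eq:
  assumes "open U" "has_weak_partial U b u v"
  shows "AE x in lebesgue_on U. weak_partial U b u x = v x"
  by (rule has_weak_partial_unique[OF assms(1) has_weak_partial_weak_partial[OF assms(2)] assms(2)])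

lemma sobolev_H_has_weak_partial:
  "u \<in> sobolev_H (Suc k) U \<Longrightarrow> b \<in> Basis \<Longrightarrow> has_weak_partial U b u (weak_partial U b u)"
  by (auto intro: has_weak_partial_weak_partial)

text \<open>This rests on the completeness of Lebesgue measure.\<close>

lemma borel_measurable_lebesgue_on_AE:
  fixes f g :: "'a::euclidean_space \<Rightarrow> real"
  assumes f: "f \<in> borel_measurable (lebesgue_on S)" and S: "S \<in> sets lebesgue"
    and ae: "AE x in lebesgue_on S. f x = g x"
  shows "g \<in> borel_measurable (lebesgue_on S)"
proof -
  have S': "S \<inter> space lebesgue \<in> sets lebesgue" using S by simp
  have "AE x in lebesgue. x \<in> S \<longrightarrow> f x = g x"
    using ae by (simp add: AE_restrict_space_iff[OF S'])
  then have "AE x in lebesgue. indicator S x *\<^sub>R f x = indicator S x *\<^sub>R g x"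
    by eventually_elim (auto simp: indicator_def)
  with f show ?thesis
    unfolding borel_measurable_restrict_space_iff[OF S'] by (rule borel_measurable_AE)
qed

lemma square_integrable_cong_AE:
  assumes U: "open U" and u: "square_integrable (lebesgue_on U) u"
    and ae: "AE x in lebesgue_on U. u x = u' x"
  shows "square_integrable (lebesgue_on U) u'"
proof -
  have 1: "u \<in> borel_measurable (lebesgue_on U)" "integrable (lebesgue_on U) (\<lambda>x. (u x)\<^sup>2)"
    using u by (auto simp: square_integrable_def)
  have 2: "u' \<in> borel_measurable (lebesgue_on U)"
    by (rule borel_measurable_lebesgue_on_AE[OF 1(1) _ ae]) (use U in auto)
  have "AE x in lebesgue_on U. (u x)\<^sup>2 = (u' x)\<^sup>2"
    using ae by eventually_elim simp
  with 1(2) 2 have "integrable (lebesgue_on U) (\<lambda>x. (u' x)\<^sup>2)"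
    by (intro integrable_cong_AE_imp[OF 1(2)]) simp_all
  with 2 show ?thesis by (simp add: square_integrable_def)
qed

lemma power2_diff_le: "(a - b)\<^sup>2 \<le> 2 * a\<^sup>2 + 2 * b\<^sup>2"
  for a b :: real
proof -
  have "2 * a\<^sup>2 + 2 * b\<^sup>2 - (a - b)\<^sup>2 = (a + b)\<^sup>2"
    by (simp add: power2_eq_square algebra_simps)
  then show ?thesis
    by (metis diff_ge_0_iff_ge zero_le_power2)
qed

lemma square_integrable_diff:
  assumes "square_integrable M f" "square_integrable M g"
  shows "square_integrable M (\<lambda>x. f x - g x)"
proof -
  have fg: "f \<in> borel_measurable M" "g \<in> borel_measurable M"
    "integrable M (\<lambda>x. (f x)\<^sup>2)" "integrable M (\<lambda>x. (g x)\<^sup>2)"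
    using assms by (auto simp: square_integrable_def)
  have "integrable M (\<lambda>x. (f x - g x)\<^sup>2)"
  proof (rule Bochner_Integration.integrable_bound)
    show "integrable M (\<lambda>x. 2 * (f x)\<^sup>2 + 2 * (g x)\<^sup>2)"
      using fg by simp
    show "AE x in M. norm ((f x - g x)\<^sup>2) \<le> norm (2 * (f x)\<^sup>2 + 2 * (g x)\<^sup>2)"
      using power2_diff_le by (intro AE_I2) simp
  qed (use fg in measurable)
  with fg show ?thesis
    by (simp add: square_integrable_def)
qed

lemma sobolev_H_square_integrable: "u \<in> sobolev_H k U \<Longrightarrow> square_integrable (lebesgue_on U) u"
  by (cases k) auto

lemma sobolev_H_diff:
  assumes "open U" "u1 \<in> sobolev_H k U" "u2 \<in> sobolev_H k U"
  shows "(\<lambda>x. u1 x - u2 x) \<in> sobolev_H k U"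
  using assms(2,3)
proof (induction k arbitrary: u1 u2)
  case 0
  then show ?case by (simp add: square_integrable_diff)
next
  case (Suc k)
  have "\<exists>v. has_weak_partial U b (\<lambda>x. u1 x - u2 x) v \<and> v \<in> sobolev_H k U" if b: "b \<in> Basis" for b
  proof -
    obtain v1 v2 where "has_weak_partial U b u1 v1" "v1 \<in> sobolev_H k U"
      "has_weak_partial U b u2 v2" "v2 \<in> sobolev_H k U"
      using Suc.prems b by force
    then show ?thesis
      using has_weak_partial_diff[OF assms(1) b] Suc.IH by blast
  qed
  then show ?case
    using Suc.prems by (simp add: square_integrable_diff)
qed

lemma has_weak_partial_loc_integrable:
  "has_weak_partial U b u v \<Longrightarrow> loc_integrable U u"
  "has_weak_partial U b u v \<Longrightarrow> loc_integrable U v"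
  by (simp_all add: has_weak_partial_def)

lemma sobolev_H_loc_integrable:
  fixes U :: "'a::euclidean_space set"
  assumes "u \<in> sobolev_H (Suc k) U"
  shows "loc_integrable U u"
proof -
  have "(SOME b. b \<in> Basis) \<in> (Basis :: 'a set)"
    by (rule someI_ex) (use nonempty_Basis in blast)
  from sobolev_H_has_weak_partial[OF assms this] show ?thesis
    by (rule has_weak_partial_loc_integrable)
qed

lemma sobolev_H_cong_AE:
  assumes U: "open U" and u: "u \<in> sobolev_H k U" and ae: "AE x in lebesgue_on U. u x = u' x"
    and loc: "loc_integrable U u'"
  shows "u' \<in> sobolev_H k U"
proof -
  have sq: "square_integrable (lebesgue_on U) u'"
    by (rule square_integrable_cong_AE[OF U sobolev_H_square_integrable[OF u] ae])
  show ?thesis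
  proof (cases k)
    case 0
    with sq show ?thesis by simp
  next
    case (Suc j)
    have "\<exists>v. has_weak_partial U b u' v \<and> v \<in> sobolev_H j U" if b: "b \<in> Basis" for b
    proof -
      obtain v where "has_weak_partial U b u v" "v \<in> sobolev_H j U"
        using u b unfolding Suc sobolev_H.simps by blast
      then show ?thesis
        using has_weak_partial_cong_AE[OF ae loc U b] by blast
    qed
    with sq Suc show ?thesis by simp
  qed
qed

lemma sobolev_H_weak_partial:
  assumes U: "open U" and u: "u \<in> sobolev_H (Suc k) U" and b: "b \<in> Basis"
  shows "weak_partial U b u \<in> sobolev_H k U"
proof -
  obtain v where v: "has_weak_partial U b u v" "v \<in> sobolev_H k U"
    using u b by auto
  have "AE x in lebesgue_on U. v x = weak_partial U b u x"
    using has_weak_partial_unique[OF U v(1) has_weak_partial_weak_partial[OF v(1)]] .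
  moreover have "loc_integrable U (weak_partial U b u)"
    using has_weak_partial_weak_partial[OF v(1)] by (simp add: has_weak_partial_def)
  ultimately show ?thesis
    by (intro sobolev_H_cong_AE[OF U v(2)])
qed

text \<open>Weak derivatives are chosen representatives, so linearity holds up to a null set only.\<close>

lemma weak_partial_diff:
  assumes U: "open U" and b: "b \<in> Basis" and "u1 \<in> sobolev_H (Suc k) U" "u2 \<in> sobolev_H (Suc k) U"
  shows "AE x in lebesgue_on U. weak_partial U b (\<lambda>x. u1 x - u2 x) x =
    weak_partial U b u1 x - weak_partial U b u2 x"
  by (intro weak_partial_eq[OF U] has_weak_partial_diff[OF U b] sobolev_H_has_weak_partial[of _ k] assms)

text \<open>The equality is literal: both choices are made from the same set of weak derivatives.\<close>

lemma weak_partial_cong_AE: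
  assumes "open U" "b \<in> Basis" "AE x in lebesgue_on U. u x = u' x" "loc_integrable U u" "loc_integrable U u'"
  shows "weak_partial U b u = weak_partial U b u'"
proof -
  have ae: "AE x in lebesgue_on U. u' x = u x"
    using assms(3) by eventually_elim simp
  have "has_weak_partial U b u v \<longleftrightarrow> has_weak_partial U b u' v" for v
  proof
    show "has_weak_partial U b u' v" if "has_weak_partial U b u v"
      using assms(3,5,1,2) that by (rule has_weak_partial_cong_AE)
    show "has_weak_partial U b u v" if "has_weak_partial U b u' v"
      using ae assms(4,1,2) that by (rule has_weak_partial_cong_AE)
  qed
  then show ?thesis by (simp only: weak_partial_def)
qed


section \<open>Linearity of traces\<close>

lemma frechet_derivative_diff:
  assumes "f differentiable at x" "g differentiable at x"
  shows "frechet_derivative (\<lambda>x. f x - g x) (at x) b =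
    frechet_derivative f (at x) b - frechet_derivative g (at x) b"
proof -
  have "((\<lambda>x. f x - g x) has_derivative
      (\<lambda>h. frechet_derivative f (at x) h - frechet_derivative g (at x) h)) (at x)"
    using assms by (intro has_derivative_diff) (simp_all add: frechet_derivative_works[symmetric])
  then show ?thesis by (simp add: frechet_derivative_eqI)
qed

lemma C1_closure_diff:
  assumes f: "C1_closure U f" and g: "C1_closure U g"
  shows "C1_closure U (\<lambda>x. f x - g x)"
  unfolding C1_closure_def
proof (intro conjI ballI)
  show "continuous_on (closure U) (\<lambda>x. f x - g x)"
    using f g by (auto simp: C1_closure_def intro: continuous_on_diff)
  show "(\<lambda>x. f x - g x) differentiable at x" if "x \<in> U" for x
    using f g that by (auto simp: C1_closure_def intro: differentiable_diff)
  fix b :: 'a assume b: "b \<in> Basis"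
  obtain f' where f': "continuous_on (closure U) f'" "\<And>x. x \<in> U \<Longrightarrow> f' x = frechet_derivative f (at x) b"
    using f b unfolding C1_closure_def by blast
  obtain g' where g': "continuous_on (closure U) g'" "\<And>x. x \<in> U \<Longrightarrow> g' x = frechet_derivative g (at x) b"
    using g b unfolding C1_closure_def by blast
  have "f' x - g' x = frechet_derivative (\<lambda>x. f x - g x) (at x) b" if "x \<in> U" for x
    using f g that f'(2)[OF that] g'(2)[OF that]
    by (simp add: C1_closure_def frechet_derivative_diff)
  then show "\<exists>k. continuous_on (closure U) k \<and>
      (\<forall>x\<in>U. k x = frechet_derivative (\<lambda>x. f x - g x) (at x) b)"
    using continuous_on_diff[OF f'(1) g'(1)] by (intro exI[of _ "\<lambda>x. f' x - g' x"]) simp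
qed

lemma C1_closure_measurable:
  assumes "open U" "C1_closure U f"
  shows "f \<in> borel_measurable (lebesgue_on U)"
proof -
  have "continuous_on U f"
    using assms(2) by (auto simp: C1_closure_def intro: continuous_on_subset[OF _ closure_subset])
  then show ?thesis
    using assms(1) by (intro continuous_imp_measurable_on_sets_lebesgue) auto
qed

lemma C1_closure_partial_measurable:
  assumes "open U" "C1_closure U f" "b \<in> Basis"
  shows "(\<lambda>x. frechet_derivative f (at x) b) \<in> borel_measurable (lebesgue_on U)"
proof -
  obtain f' where f': "continuous_on (closure U) f'" "\<And>x. x \<in> U \<Longrightarrow> f' x = frechet_derivative f (at x) b"
    using assms(2,3) unfolding C1_closure_def by blast
  have "f' \<in> borel_measurable (lebesgue_on U)"
    using assms(1) continuous_on_subset[OF f'(1) closure_subset]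
    by (intro continuous_imp_measurable_on_sets_lebesgue) auto
  moreover have "f' \<in> borel_measurable (lebesgue_on U) \<longleftrightarrow>
      (\<lambda>x. frechet_derivative f (at x) b) \<in> borel_measurable (lebesgue_on U)"
    by (rule measurable_cong) (simp add: f'(2))
  ultimately show ?thesis by simp
qed

lemma L2_tendsto_cong_AE:
  assumes "\<And>k x. x \<in> space M \<Longrightarrow> f k x = f' k x" "AE x in M. g x = g' x"
  shows "L2_tendsto M f g \<longleftrightarrow> L2_tendsto M f' g'"
proof -
  have "(\<integral>\<^sup>+x. ennreal ((f k x - g x)\<^sup>2) \<partial>M) = (\<integral>\<^sup>+x. ennreal ((f' k x - g' x)\<^sup>2) \<partial>M)" for k
  proof (rule nn_integral_cong_AE)
    show "AE x in M. ennreal ((f k x - g x)\<^sup>2) = ennreal ((f' k x - g' x)\<^sup>2)"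
      using assms(2) AE_space by eventually_elim (simp add: assms(1))
  qed
  then show ?thesis by (simp add: L2_tendsto_def)
qed

lemma L2_tendsto_diff:
  assumes [measurable]: "\<And>k. f1 k \<in> borel_measurable M" "\<And>k. f2 k \<in> borel_measurable M"
    "g1 \<in> borel_measurable M" "g2 \<in> borel_measurable M"
    and 1: "L2_tendsto M f1 g1" and 2: "L2_tendsto M f2 g2"
  shows "L2_tendsto M (\<lambda>k x. f1 k x - f2 k x) (\<lambda>x. g1 x - g2 x)"
  unfolding L2_tendsto_def
proof (rule tendsto_sandwich[OF _ _ tendsto_const])
  let ?I1 = "\<lambda>k. \<integral>\<^sup>+x. ennreal ((f1 k x - g1 x)\<^sup>2) \<partial>M" and ?I2 = "\<lambda>k. \<integral>\<^sup>+x. ennreal ((f2 k x - g2 x)\<^sup>2) \<partial>M"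
  have "(\<lambda>k. 2 * ?I1 k + 2 * ?I2 k) \<longlonglongrightarrow> 2 * 0 + 2 * 0"
    using 1 2 unfolding L2_tendsto_def by (intro tendsto_add ennreal_tendsto_cmult) auto
  then show "(\<lambda>k. 2 * ?I1 k + 2 * ?I2 k) \<longlonglongrightarrow> 0" by simp
  have "(\<integral>\<^sup>+x. ennreal ((f1 k x - f2 k x - (g1 x - g2 x))\<^sup>2) \<partial>M) \<le> 2 * ?I1 k + 2 * ?I2 k" for k
  proof -
    have "(\<integral>\<^sup>+x. ennreal ((f1 k x - f2 k x - (g1 x - g2 x))\<^sup>2) \<partial>M) \<le>
        (\<integral>\<^sup>+x. 2 * ennreal ((f1 k x - g1 x)\<^sup>2) + 2 * ennreal ((f2 k x - g2 x)\<^sup>2) \<partial>M)"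
    proof (rule nn_integral_mono)
      fix x
      have "(f1 k x - f2 k x - (g1 x - g2 x))\<^sup>2 \<le> 2 * (f1 k x - g1 x)\<^sup>2 + 2 * (f2 k x - g2 x)\<^sup>2"
        using power2_diff_le[of "f1 k x - g1 x" "f2 k x - g2 x"] by (simp add: algebra_simps)
      then have "ennreal ((f1 k x - f2 k x - (g1 x - g2 x))\<^sup>2) \<le>
          ennreal (2 * (f1 k x - g1 x)\<^sup>2 + 2 * (f2 k x - g2 x)\<^sup>2)"
        by (rule ennreal_leI)
      then show "ennreal ((f1 k x - f2 k x - (g1 x - g2 x))\<^sup>2) \<le>
          2 * ennreal ((f1 k x - g1 x)\<^sup>2) + 2 * ennreal ((f2 k x - g2 x)\<^sup>2)"
        by (simp add: ennreal_plus ennreal_mult)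
    qed
    also have "\<dots> = 2 * ?I1 k + 2 * ?I2 k"
      by (simp add: nn_integral_add nn_integral_cmult)
    finally show ?thesis .
  qed
  then show "\<forall>\<^sub>F k in sequentially. (\<integral>\<^sup>+x. ennreal ((f1 k x - f2 k x - (g1 x - g2 x))\<^sup>2) \<partial>M) \<le> 2 * ?I1 k + 2 * ?I2 k"
    by simp
qed simp

lemma sobolev_H_measurable: "u \<in> sobolev_H k U \<Longrightarrow> u \<in> borel_measurable (lebesgue_on U)"
  using sobolev_H_square_integrable unfolding square_integrable_def by blast

text \<open>Subtract the approximating \<open>C\<^sup>1\<close> sequences. The measurability condition on \<open>\<iota>\<close> enters
  because the triangle inequality for the integrals of squares rests on additivity, which
  nonnegative integrals have for measurable functions.\<close>

lemma has_trace_diff: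
  assumes U: "open U"
    and meas: "\<And>v :: _ \<Rightarrow> real. continuous_on (closure U) v \<Longrightarrow> (\<lambda>y. v (\<iota> y)) \<in> borel_measurable M"
    and 1: "has_trace U M \<iota> u1 g1" and 2: "has_trace U M \<iota> u2 g2"
  shows "has_trace U M \<iota> (\<lambda>x. u1 x - u2 x) (\<lambda>y. g1 y - g2 y)"
proof -
  have u: "u1 \<in> sobolev_H (Suc 0) U" "u2 \<in> sobolev_H (Suc 0) U"
    and g: "square_integrable M g1" "square_integrable M g2"
    using 1 2 unfolding has_trace_def One_nat_def by blast+
  obtain v1 where v1: "\<And>k. C1_closure U (v1 k)" "L2_tendsto (lebesgue_on U) v1 u1"
      "\<And>b. b \<in> Basis \<Longrightarrow> L2_tendsto (lebesgue_on U)
         (\<lambda>k x. frechet_derivative (v1 k) (at x) b) (weak_partial U b u1)"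
      "L2_tendsto M (\<lambda>k y. v1 k (\<iota> y)) g1"
    using 1 unfolding has_trace_def by blast
  obtain v2 where v2: "\<And>k. C1_closure U (v2 k)" "L2_tendsto (lebesgue_on U) v2 u2"
      "\<And>b. b \<in> Basis \<Longrightarrow> L2_tendsto (lebesgue_on U)
         (\<lambda>k x. frechet_derivative (v2 k) (at x) b) (weak_partial U b u2)"
      "L2_tendsto M (\<lambda>k y. v2 k (\<iota> y)) g2"
    using 2 unfolding has_trace_def by blast
  define v where "v k x = v1 k x - v2 k x" for k x
  have "C1_closure U (v k)" for k
    using C1_closure_diff[OF v1(1) v2(1)] by (simp add: v_def[abs_def])
  moreover have "L2_tendsto (lebesgue_on U) v (\<lambda>x. u1 x - u2 x)"
    unfolding v_def[abs_def]
    by (intro L2_tendsto_diff C1_closure_measurable[OF U] v1 v2 sobolev_H_measurable[OF u(1)] sobolev_H_measurable[OF u(2)])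
  moreover have "L2_tendsto (lebesgue_on U) (\<lambda>k x. frechet_derivative (v k) (at x) b)
      (weak_partial U b (\<lambda>x. u1 x - u2 x))" if b: "b \<in> Basis" for b
  proof -
    have "L2_tendsto (lebesgue_on U)
        (\<lambda>k x. frechet_derivative (v1 k) (at x) b - frechet_derivative (v2 k) (at x) b)
        (\<lambda>x. weak_partial U b u1 x - weak_partial U b u2 x)"
      by (intro L2_tendsto_diff C1_closure_partial_measurable[OF U _ b] v1(1) v2(1) v1(3) v2(3) b
          sobolev_H_measurable[OF sobolev_H_weak_partial[OF U u(1) b]]
          sobolev_H_measurable[OF sobolev_H_weak_partial[OF U u(2) b]])
    moreover have "frechet_derivative (v k) (at x) b =
        frechet_derivative (v1 k) (at x) b - frechet_derivative (v2 k) (at x) b" if "x \<in> U" for k x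
      using v1(1)[of k] v2(1)[of k] that by (simp add: C1_closure_def v_def[abs_def] frechet_derivative_diff)
    ultimately show ?thesis
      using weak_partial_diff[OF U b u] by (subst L2_tendsto_cong_AE) simp_all
  qed
  moreover have "L2_tendsto M (\<lambda>k y. v k (\<iota> y)) (\<lambda>y. g1 y - g2 y)"
  proof -
    have c: "continuous_on (closure U) (v1 k)" "continuous_on (closure U) (v2 k)" for k
      using v1(1)[of k] v2(1)[of k] by (auto simp: C1_closure_def)
    have "(\<lambda>y. v1 k (\<iota> y)) \<in> borel_measurable M" "(\<lambda>y. v2 k (\<iota> y)) \<in> borel_measurable M" for k
      by (rule meas[OF c(1)], rule meas[OF c(2)])
    with g v1(4) v2(4) show ?thesis
      unfolding v_def by (intro L2_tendsto_diff) (simp_all add: square_integrable_def)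
  qed
  ultimately show ?thesis
    unfolding has_trace_def One_nat_def
    using sobolev_H_diff[OF U u] square_integrable_diff[OF g] by blast
qed

lemma has_trace_cong_AE:
  assumes U: "open U" and ae: "AE x in lebesgue_on U. u x = u' x" and loc: "loc_integrable U u'"
    and tr: "has_trace U M \<iota> u g"
  shows "has_trace U M \<iota> u' g"
proof -
  have u: "u \<in> sobolev_H (Suc 0) U"
    using tr unfolding has_trace_def One_nat_def by blast
  have "weak_partial U b u = weak_partial U b u'" if "b \<in> Basis" for b
    by (rule weak_partial_cong_AE[OF U that ae sobolev_H_loc_integrable[OF u] loc])
  moreover have "L2_tendsto (lebesgue_on U) v u \<longleftrightarrow> L2_tendsto (lebesgue_on U) v u'" for v
    by (rule L2_tendsto_cong_AE[OF refl ae])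
  ultimately show ?thesis
    using tr sobolev_H_cong_AE[OF U u ae loc] unfolding has_trace_def One_nat_def by simp
qed

lemma has_trace_weak_partial_diff:
  assumes U: "open U" and b: "b \<in> Basis"
    and meas: "\<And>v :: _ \<Rightarrow> real. continuous_on (closure U) v \<Longrightarrow> (\<lambda>y. v (\<iota> y)) \<in> borel_measurable M"
    and u: "u1 \<in> sobolev_H (Suc k) U" "u2 \<in> sobolev_H (Suc k) U"
    and 1: "has_trace U M \<iota> (weak_partial U b u1) g1" and 2: "has_trace U M \<iota> (weak_partial U b u2) g2"
  shows "has_trace U M \<iota> (weak_partial U b (\<lambda>x. u1 x - u2 x)) (\<lambda>y. g1 y - g2 y)"
proof (rule has_trace_cong_AE[OF U _ _ has_trace_diff[OF U meas 1 2]])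
  show "AE x in lebesgue_on U. weak_partial U b u1 x - weak_partial U b u2 x =
      weak_partial U b (\<lambda>x. u1 x - u2 x) x"
    using weak_partial_diff[OF U b u] by eventually_elim simp
  show "loc_integrable U (weak_partial U b (\<lambda>x. u1 x - u2 x))"
    by (rule has_weak_partial_loc_integrable(2)[OF sobolev_H_has_weak_partial[OF sobolev_H_diff[OF U u] b]])
qed

lemma open_cyl: "open \<Omega> \<Longrightarrow> open (cyl \<Omega> s T)"
  by (simp add: cyl_def open_Times)

lemma dir_x_Basis: "dir_x i \<in> Basis" and dir_t_Basis: "dir_t \<in> Basis"
  by (auto simp: dir_x_def dir_t_def Basis_prod_def axis_in_Basis_iff)

text \<open>Hausdorff measure is defined on the Borel sets, so continuity suffices.\<close>

lemma lateral_trace_measurable: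
  fixes v :: "'n::finite spacetime \<Rightarrow> real"
  assumes "continuous_on (closure (cyl \<Omega> 0 T)) v"
  shows "(\<lambda>y. v (id y)) \<in>
    borel_measurable (restrict_space (hausdorff_measure n) (frontier \<Omega> \<times> {0<..<T}))"
proof -
  have "sets (hausdorff_measure n :: 'n spacetime measure) = sets borel"
    using sets.sigma_sets_eq[of "borel :: 'n spacetime measure"] by (simp add: hausdorff_measure_def)
  then have "sets (restrict_space (hausdorff_measure n) (frontier \<Omega> \<times> {0<..<T})) =
      sets (restrict_space borel (frontier \<Omega> \<times> {0<..<T}))"
    by (rule sets_restrict_space_cong)
  moreover have "frontier \<Omega> \<times> {0<..<T} \<subseteq> closure (cyl \<Omega> 0 T)"
    using closure_subset[of "{0<..<T}"] by (auto simp: cyl_def closure_Times frontier_def)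
  ultimately show ?thesis
    using borel_measurable_continuous_on_restrict[OF continuous_on_subset[OF assms]]
    by (simp cong: measurable_cong_sets)
qed

lemma slice_trace_measurable:
  fixes v :: "'n::finite spacetime \<Rightarrow> real"
  assumes "open \<Omega>" "0 < T" "s \<in> {0..T}" "continuous_on (closure (cyl \<Omega> 0 T)) v"
  shows "(\<lambda>x. v (x, s)) \<in> borel_measurable (lebesgue_on \<Omega>)"
proof (rule continuous_imp_measurable_on_sets_lebesgue)
  have "(\<lambda>x. (x, s)) ` \<Omega> \<subseteq> closure (cyl \<Omega> 0 T)"
    using closure_subset[of \<Omega>] assms(2,3) by (auto simp: cyl_def closure_Times)
  then show "continuous_on \<Omega> (\<lambda>x. v (x, s))"
    using assms(4) by (intro continuous_on_compose2[OF assms(4)] continuous_intros)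
qed (use assms(1) in auto)

lemma zero_lateral_diff:
  assumes "open \<Omega>" "zero_lateral \<Omega> T u1" "zero_lateral \<Omega> T u2"
  shows "zero_lateral \<Omega> T (\<lambda>z. u1 z - u2 z)"
proof -
  have "has_trace (cyl \<Omega> 0 T)
      (restrict_space (hausdorff_measure CARD('a)) (frontier \<Omega> \<times> {0<..<T})) id
      (\<lambda>z. u1 z - u2 z) (\<lambda>_. 0 - 0)"
    by (rule has_trace_diff[OF open_cyl[OF assms(1)] _ assms(2,3)[unfolded zero_lateral_def]])
      (rule lateral_trace_measurable)
  then show ?thesis by (simp add: zero_lateral_def)
qed

lemma trace_at_diff:
  assumes "open \<Omega>" "0 < T" "s \<in> {0..T}" "trace_at \<Omega> T s u1 g1" "trace_at \<Omega> T s u2 g2"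
  shows "trace_at \<Omega> T s (\<lambda>z. u1 z - u2 z) (\<lambda>x. g1 x - g2 x)"
  unfolding trace_at_def
  by (rule has_trace_diff[OF open_cyl[OF assms(1)] _ assms(4,5)[unfolded trace_at_def]])
    (rule slice_trace_measurable[OF assms(1-3)])

lemma grad_trace_at_diff:
  assumes "open \<Omega>" "0 < T" "s \<in> {0..T}"
    and "u1 \<in> sobolev_H (Suc k) (cyl \<Omega> 0 T)" "u2 \<in> sobolev_H (Suc k) (cyl \<Omega> 0 T)"
    and "grad_trace_at \<Omega> T s u1 h1" "grad_trace_at \<Omega> T s u2 h2"
  shows "grad_trace_at \<Omega> T s (\<lambda>z. u1 z - u2 z) (\<lambda>x. h1 x - h2 x)"
  unfolding grad_trace_at_def trace_at_def
proof
  fix i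
  show "has_trace (cyl \<Omega> 0 T) (lebesgue_on \<Omega>) (\<lambda>x. (x, s))
      (weak_partial (cyl \<Omega> 0 T) (dir_x i) (\<lambda>z. u1 z - u2 z)) (\<lambda>x. (h1 x - h2 x) $ i)"
    unfolding vector_minus_component
  proof (rule has_trace_weak_partial_diff[OF open_cyl[OF assms(1)] dir_x_Basis _ assms(4,5)])
    show "has_trace (cyl \<Omega> 0 T) (lebesgue_on \<Omega>) (\<lambda>x. (x, s))
        (weak_partial (cyl \<Omega> 0 T) (dir_x i) u1) (\<lambda>x. h1 x $ i)"
      "has_trace (cyl \<Omega> 0 T) (lebesgue_on \<Omega>) (\<lambda>x. (x, s))
        (weak_partial (cyl \<Omega> 0 T) (dir_x i) u2) (\<lambda>x. h2 x $ i)"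
      using assms(6,7) by (simp_all add: grad_trace_at_def trace_at_def)
  qed (rule slice_trace_measurable[OF assms(1-3)])
qed


section \<open>The weighted energy of the difference of two solutions\<close>

lemma grad_x_diff:
  fixes u1 u2 :: "'n::finite spacetime \<Rightarrow> real"
  assumes "open Q" "u1 \<in> sobolev_H (Suc k) Q" "u2 \<in> sobolev_H (Suc k) Q"
  shows "AE z in lebesgue_on Q. grad_x Q (\<lambda>z. u1 z - u2 z) z = grad_x Q u1 z - grad_x Q u2 z"
proof -
  have "AE z in lebesgue_on Q. \<forall>i. weak_partial Q (dir_x i) (\<lambda>z. u1 z - u2 z) z =
      weak_partial Q (dir_x i) u1 z - weak_partial Q (dir_x i) u2 z"
    by (subst AE_all_countable) (intro allI weak_partial_diff[OF assms(1) dir_x_Basis assms(2,3)])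
  then show ?thesis
    by eventually_elim (simp add: grad_x_def vec_eq_iff)
qed

text \<open>A second derivative of \<open>u1 - u2\<close> is the weak derivative of a chosen representative of the first
  one, which agrees only almost everywhere with the difference of the representatives for \<open>u1\<close> and
  \<open>u2\<close>; weak derivatives do not see this.\<close>

lemma Lop_diff:
  fixes u1 u2 :: "'n::finite spacetime \<Rightarrow> real"
  assumes Q: "open Q" and u: "u1 \<in> sobolev_H (Suc (Suc k)) Q" "u2 \<in> sobolev_H (Suc (Suc k)) Q"
  shows "AE z in lebesgue_on Q. Lop a Q (\<lambda>z. u1 z - u2 z) z = Lop a Q u1 z - Lop a Q u2 z"
proof -
  have D: "AE z in lebesgue_on Q. weak_partial Q (dir_x j) (weak_partial Q (dir_x i) (\<lambda>z. u1 z - u2 z)) z =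
      weak_partial Q (dir_x j) (weak_partial Q (dir_x i) u1) z -
      weak_partial Q (dir_x j) (weak_partial Q (dir_x i) u2) z" for i j :: 'n
  proof -
    let ?v1 = "weak_partial Q (dir_x i) u1" and ?v2 = "weak_partial Q (dir_x i) u2"
    have v: "?v1 \<in> sobolev_H (Suc k) Q" "?v2 \<in> sobolev_H (Suc k) Q"
      by (intro sobolev_H_weak_partial[OF Q _ dir_x_Basis] u)+
    have w: "weak_partial Q (dir_x i) (\<lambda>z. u1 z - u2 z) \<in> sobolev_H (Suc k) Q"
      by (rule sobolev_H_weak_partial[OF Q sobolev_H_diff[OF Q u] dir_x_Basis])
    have "weak_partial Q (dir_x j) (weak_partial Q (dir_x i) (\<lambda>z. u1 z - u2 z)) =
        weak_partial Q (dir_x j) (\<lambda>z. ?v1 z - ?v2 z)"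
      by (rule weak_partial_cong_AE[OF Q dir_x_Basis weak_partial_diff[OF Q dir_x_Basis u]
          sobolev_H_loc_integrable[OF w] sobolev_H_loc_integrable[OF sobolev_H_diff[OF Q v]]])
    then show ?thesis
      using weak_partial_diff[OF Q dir_x_Basis v, of j] by simp
  qed
  have "AE z in lebesgue_on Q. \<forall>i j. weak_partial Q (dir_x j) (weak_partial Q (dir_x i) (\<lambda>z. u1 z - u2 z)) z =
      weak_partial Q (dir_x j) (weak_partial Q (dir_x i) u1) z -
      weak_partial Q (dir_x j) (weak_partial Q (dir_x i) u2) z"
    unfolding AE_all_countable using D by blast
  then show ?thesis
    by eventually_elim (simp add: Lop_def right_diff_distrib sum_subtractf)
qed

lemma grad_x_subset:
  fixes u :: "'n::finite spacetime \<Rightarrow> real"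
  assumes "open Q" "open R" "R \<subseteq> Q" "u \<in> sobolev_H (Suc k) Q"
  shows "AE z in lebesgue_on R. grad_x R u z = grad_x Q u z"
proof -
  have "AE z in lebesgue_on R. \<forall>i. weak_partial R (dir_x i) u z = weak_partial Q (dir_x i) u z"
    by (subst AE_all_countable) (intro allI weak_partial_eq has_weak_partial_subset[OF assms(1-3)]
        assms(2) sobolev_H_has_weak_partial[OF assms(4) dir_x_Basis])
  then show ?thesis
    by eventually_elim (simp add: grad_x_def)
qed

lemma integrable_grad_x:
  fixes u :: "'n::finite spacetime \<Rightarrow> real"
  assumes "open Q" "u \<in> sobolev_H (Suc k) Q"
  shows "integrable (lebesgue_on Q) (\<lambda>z. (norm (grad_x Q u z))\<^sup>2)"
proof -
  have "integrable (lebesgue_on Q) (\<lambda>z. (weak_partial Q (dir_x i) u z)\<^sup>2)" for i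
    using sobolev_H_square_integrable[OF sobolev_H_weak_partial[OF assms dir_x_Basis, of i]]
    by (simp add: square_integrable_def)
  then have "integrable (lebesgue_on Q) (\<lambda>z. \<Sum>i\<in>UNIV. (weak_partial Q (dir_x i) u z)\<^sup>2)"
    by (intro Bochner_Integration.integrable_sum)
  then show ?thesis
    by (simp add: norm_vec_def L2_set_def sum_nonneg grad_x_def)
qed

text \<open>The Carleman weight is bounded above on the cylinder.\<close>

lemma integrable_weighted:
  fixes f :: "'n::finite spacetime \<Rightarrow> real"
  assumes \<Omega>: "open \<Omega>" and "T > 0" and f: "integrable (lebesgue_on (cyl \<Omega> 0 T)) f"
  shows "integrable (lebesgue_on (cyl \<Omega> 0 T)) (\<lambda>z. f z * exp (2 * (snd z + 1) powr \<nu>))"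
proof (rule Bochner_Integration.integrable_bound)
  \<comment> \<open>The 1 covers negative \<open>\<nu>\<close>, for which the weight decreases in time.\<close>
  let ?B = "exp (2 * max 1 ((T + 1) powr \<nu>))"
  show "integrable (lebesgue_on (cyl \<Omega> 0 T)) (\<lambda>z. ?B * f z)"
    using f by simp
  have "continuous_on (cyl \<Omega> 0 T) (\<lambda>z. exp (2 * (snd z + 1) powr \<nu>))"
    by (intro continuous_intros) (auto simp: cyl_def)
  then have "(\<lambda>z. exp (2 * (snd z + 1) powr \<nu>)) \<in> borel_measurable (lebesgue_on (cyl \<Omega> 0 T))"
    using open_cyl[OF \<Omega>] by (intro continuous_imp_measurable_on_sets_lebesgue) auto
  then show "(\<lambda>z. f z * exp (2 * (snd z + 1) powr \<nu>)) \<in> borel_measurable (lebesgue_on (cyl \<Omega> 0 T))"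
    using f by (intro borel_measurable_times) auto
  show "AE z in lebesgue_on (cyl \<Omega> 0 T). norm (f z * exp (2 * (snd z + 1) powr \<nu>)) \<le> norm (?B * f z)"
  proof (rule AE_I2)
    fix z assume "z \<in> space (lebesgue_on (cyl \<Omega> 0 T))"
    then have z: "0 < snd z" "snd z < T"
      by (auto simp: cyl_def)
    have "(snd z + 1) powr \<nu> \<le> max 1 ((T + 1) powr \<nu>)"
    proof (cases "\<nu> \<ge> 0")
      case True
      then have "(snd z + 1) powr \<nu> \<le> (T + 1) powr \<nu>"
        using z by (intro powr_mono2) auto
      then show ?thesis by simp
    next
      case False
      then have "(snd z + 1) powr \<nu> \<le> (snd z + 1) powr 0"
        using z by (intro powr_mono) auto
      then show ?thesis using z by simp
    qed
    then show "norm (f z * exp (2 * (snd z + 1) powr \<nu>)) \<le> norm (?B * f z)"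
      by (simp add: abs_mult mult.commute[of "\<bar>f z\<bar>"] mult_right_mono)
  qed
qed

lemma L2norm_diff_le:
  fixes h1 h2 :: "'a \<Rightarrow> real^'n::finite"
  assumes "\<And>i. square_integrable N (\<lambda>x. h1 x $ i)" "\<And>i. square_integrable N (\<lambda>x. h2 x $ i)"
    and "L2norm N h1 \<le> M" "L2norm N h2 \<le> M"
  shows "(L2norm N (\<lambda>x. h1 x - h2 x))\<^sup>2 \<le> 4 * M\<^sup>2"
proof -
  have int: "integrable N (\<lambda>x. (norm (h x))\<^sup>2)" if "\<And>i. square_integrable N (\<lambda>x. h x $ i)" for h :: "'a \<Rightarrow> real^'n"
  proof -
    have "integrable N (\<lambda>x. \<Sum>i\<in>UNIV. (h x $ i)\<^sup>2)"
      using that by (intro Bochner_Integration.integrable_sum) (simp add: square_integrable_def)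
    then show ?thesis
      by (simp add: norm_vec_def L2_set_def sum_nonneg)
  qed
  have sq: "(L2norm N h)\<^sup>2 = (LINT x|N. (norm (h x))\<^sup>2)" for h :: "'a \<Rightarrow> real^'n"
    by (simp add: L2norm_def)
  have M: "(L2norm N h)\<^sup>2 \<le> M\<^sup>2" if "L2norm N h \<le> M" for h :: "'a \<Rightarrow> real^'n"
    using that by (intro power_mono) (auto simp: L2norm_def)
  have "(L2norm N (\<lambda>x. h1 x - h2 x))\<^sup>2 \<le> (LINT x|N. 2 * (norm (h1 x))\<^sup>2 + 2 * (norm (h2 x))\<^sup>2)"
    unfolding sq
  proof (rule integral_mono_AE')
    show "integrable N (\<lambda>x. 2 * (norm (h1 x))\<^sup>2 + 2 * (norm (h2 x))\<^sup>2)"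
      using int[OF assms(1)] int[OF assms(2)] by simp
    show "AE x in N. (norm (h1 x - h2 x))\<^sup>2 \<le> 2 * (norm (h1 x))\<^sup>2 + 2 * (norm (h2 x))\<^sup>2"
    proof (rule AE_I2)
      fix x
      have "(norm (h1 x - h2 x))\<^sup>2 \<le> (norm (h1 x) - (- norm (h2 x)))\<^sup>2"
        by (intro power_mono) (auto intro: norm_triangle_ineq4)
      also have "\<dots> \<le> 2 * (norm (h1 x))\<^sup>2 + 2 * (norm (h2 x))\<^sup>2"
        using power2_diff_le[of "norm (h1 x)" "- norm (h2 x)"] by simp
      finally show "(norm (h1 x - h2 x))\<^sup>2 \<le> 2 * (norm (h1 x))\<^sup>2 + 2 * (norm (h2 x))\<^sup>2" .
    qed
  qed simp
  also have "\<dots> = 2 * (L2norm N h1)\<^sup>2 + 2 * (L2norm N h2)\<^sup>2"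
    unfolding sq using int[OF assms(1)] int[OF assms(2)] by simp
  also have "\<dots> \<le> 4 * M\<^sup>2"
    using M[OF assms(3)] M[OF assms(4)] by simp
  finally show ?thesis .
qed

text \<open>The last conclusion is where the nonlinearity disappears: the difference satisfies a linear
  differential inequality with constant \<open>Cbar\<^sup>2\<close>. The points \<open>(x, t)\<close> in the two arguments of \<open>F\<close>
  coincide, so the distance of the arguments is that of the values and gradients alone.\<close>

lemma solution_difference:
  fixes u1 u2 w :: "'n::finite spacetime \<Rightarrow> real"
  assumes \<Omega>: "open \<Omega>" and T: "T > 0" and w_def: "w = (\<lambda>z. u1 z - u2 z)"
    and F: "Cbar-lipschitz_on UNIV F"
    and s1: "solves_terminal_problem \<Omega> T a F g1 u1" and s2: "solves_terminal_problem \<Omega> T a F g2 u2"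
  shows "w \<in> sobolev_H 2 (cyl \<Omega> 0 T)"
    and "zero_lateral \<Omega> T w"
    and "trace_at \<Omega> T T w (\<lambda>x. g1 x - g2 x)"
    and "AE z in lebesgue_on (cyl \<Omega> 0 T).
      (Dt (cyl \<Omega> 0 T) w z - Lop a (cyl \<Omega> 0 T) w z)\<^sup>2 \<le>
      Cbar\<^sup>2 * ((norm (grad_x (cyl \<Omega> 0 T) w z))\<^sup>2 + (w z)\<^sup>2)"
proof -
  let ?Q = "cyl \<Omega> 0 T"
  have Q: "open ?Q" by (rule open_cyl[OF \<Omega>])
  have u: "u1 \<in> sobolev_H (Suc (Suc 0)) ?Q" "u2 \<in> sobolev_H (Suc (Suc 0)) ?Q"
    using s1 s2 unfolding solves_terminal_problem_def numeral_2_eq_2 by blast+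
  show "w \<in> sobolev_H 2 ?Q"
    unfolding w_def numeral_2_eq_2 by (rule sobolev_H_diff[OF Q u])
  show "zero_lateral \<Omega> T w"
    using s1 s2 unfolding w_def solves_terminal_problem_def by (blast intro: zero_lateral_diff[OF \<Omega>])
  show "trace_at \<Omega> T T w (\<lambda>x. g1 x - g2 x)"
    unfolding w_def
    by (rule trace_at_diff[OF \<Omega> T]) (use s1 s2 T in \<open>auto simp: solves_terminal_problem_def\<close>)
  have "AE z in lebesgue_on ?Q. Dt ?Q u1 z = Lop a ?Q u1 z + F (grad_x ?Q u1 z, u1 z, fst z, snd z)"
    "AE z in lebesgue_on ?Q. Dt ?Q u2 z = Lop a ?Q u2 z + F (grad_x ?Q u2 z, u2 z, fst z, snd z)"
    using s1 s2 unfolding solves_terminal_problem_def by blast+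
  moreover have "AE z in lebesgue_on ?Q. Dt ?Q w z = Dt ?Q u1 z - Dt ?Q u2 z"
    unfolding Dt_def w_def by (rule weak_partial_diff[OF Q dir_t_Basis u])
  moreover have "AE z in lebesgue_on ?Q. Lop a ?Q w z = Lop a ?Q u1 z - Lop a ?Q u2 z"
    unfolding w_def by (rule Lop_diff[OF Q u])
  moreover have "AE z in lebesgue_on ?Q. grad_x ?Q w z = grad_x ?Q u1 z - grad_x ?Q u2 z"
    unfolding w_def by (rule grad_x_diff[OF Q u])
  ultimately show "AE z in lebesgue_on ?Q. (Dt ?Q w z - Lop a ?Q w z)\<^sup>2 \<le>
      Cbar\<^sup>2 * ((norm (grad_x ?Q w z))\<^sup>2 + (w z)\<^sup>2)"
  proof eventually_elim
    case (elim z)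
    let ?y1 = "(grad_x ?Q u1 z, u1 z, fst z, snd z)" and ?y2 = "(grad_x ?Q u2 z, u2 z, fst z, snd z)"
    have wz: "w z = u1 z - u2 z"
      by (simp add: w_def)
    have "(dist ?y1 ?y2)\<^sup>2 = (norm (grad_x ?Q w z))\<^sup>2 + (w z)\<^sup>2"
      by (simp add: elim wz dist_prod_def dist_norm)
    moreover have "\<bar>F ?y1 - F ?y2\<bar> \<le> Cbar * dist ?y1 ?y2"
      using lipschitz_onD[OF F, of ?y1 ?y2] by (simp add: dist_real_def)
    then have "\<bar>F ?y1 - F ?y2\<bar>\<^sup>2 \<le> (Cbar * dist ?y1 ?y2)\<^sup>2"
      by (intro power_mono) auto
    moreover have "Dt ?Q w z - Lop a ?Q w z = F ?y1 - F ?y2"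
      by (simp add: elim)
    ultimately show ?case
      by (simp add: power_mult_distrib)
  qed
qed

text \<open>Half of the term \<open>C sqrt \<nu>\<close> times the weighted energy absorbs the differential inequality, and
  the other half remains. For the term in \<open>w\<^sup>2\<close> the Carleman estimate has the larger factor \<open>\<nu>\<^sup>2\<close>,
  of which only \<open>sqrt \<nu>\<close> is kept.\<close>

lemma weighted_energy_bound:
  fixes w :: "'n::finite spacetime \<Rightarrow> real"
  assumes \<Omega>: "open \<Omega>" and T: "T > 0"
    and car: "carleman_estimate \<Omega> T a \<nu>0 C" and C: "C > 0"
    and \<nu>: "\<nu> \<ge> \<nu>0" "\<nu> \<ge> 1" and K: "2 * K \<le> C * sqrt \<nu>"
    and w: "w \<in> sobolev_H 2 (cyl \<Omega> 0 T)" "zero_lateral \<Omega> T w"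
    and g: "trace_at \<Omega> T T w g" and h: "grad_trace_at \<Omega> T 0 w h"
    and ineq: "AE z in lebesgue_on (cyl \<Omega> 0 T).
      (Dt (cyl \<Omega> 0 T) w z - Lop a (cyl \<Omega> 0 T) w z)\<^sup>2 \<le>
      K * ((norm (grad_x (cyl \<Omega> 0 T) w z))\<^sup>2 + (w z)\<^sup>2)"
  shows "sqrt \<nu> * (LINT z|lebesgue_on (cyl \<Omega> 0 T).
      ((norm (grad_x (cyl \<Omega> 0 T) w z))\<^sup>2 + (w z)\<^sup>2) * exp (2 * (snd z + 1) powr \<nu>))
    \<le> 2 * (exp (3 * (T + 1) powr \<nu>) * (L2norm (lebesgue_on \<Omega>) g)\<^sup>2 + (L2norm (lebesgue_on \<Omega>) h)\<^sup>2)"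
    and "integrable (lebesgue_on (cyl \<Omega> 0 T))
      (\<lambda>z. ((norm (grad_x (cyl \<Omega> 0 T) w z))\<^sup>2 + (w z)\<^sup>2) * exp (2 * (snd z + 1) powr \<nu>))"
proof -
  let ?Q = "cyl \<Omega> 0 T"
  let ?e = "\<lambda>z::'n spacetime. exp (2 * (snd z + 1) powr \<nu>)"
  have Q: "open ?Q" by (rule open_cyl[OF \<Omega>])
  have w1: "w \<in> sobolev_H (Suc (Suc 0)) ?Q"
    using w(1) unfolding numeral_2_eq_2 .
  define I1 where "I1 = (LINT z|lebesgue_on ?Q. (norm (grad_x ?Q w z))\<^sup>2 * ?e z)"
  define I2 where "I2 = (LINT z|lebesgue_on ?Q. (w z)\<^sup>2 * ?e z)"
  define I where "I = (LINT z|lebesgue_on ?Q. ((norm (grad_x ?Q w z))\<^sup>2 + (w z)\<^sup>2) * ?e z)"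
  define B where "B = exp (3 * (T + 1) powr \<nu>) * (L2norm (lebesgue_on \<Omega>) g)\<^sup>2 + (L2norm (lebesgue_on \<Omega>) h)\<^sup>2"
  have int1: "integrable (lebesgue_on ?Q) (\<lambda>z. (norm (grad_x ?Q w z))\<^sup>2 * ?e z)"
    by (rule integrable_weighted[OF \<Omega> T integrable_grad_x[OF Q w1]])
  have int2: "integrable (lebesgue_on ?Q) (\<lambda>z. (w z)\<^sup>2 * ?e z)"
    using sobolev_H_square_integrable[OF w1]
    by (intro integrable_weighted[OF \<Omega> T]) (simp add: square_integrable_def)
  show int: "integrable (lebesgue_on ?Q) (\<lambda>z. ((norm (grad_x ?Q w z))\<^sup>2 + (w z)\<^sup>2) * ?e z)"
    using Bochner_Integration.integrable_add[OF int1 int2] by (simp add: distrib_right)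
  have I: "I = I1 + I2"
    using Bochner_Integration.integral_add[OF int1 int2] by (simp add: I_def I1_def I2_def distrib_right)
  have nonneg: "0 \<le> I2" "0 \<le> I"
    by (simp_all add: I2_def I_def)
  have "C * sqrt \<nu> * I1 + C * \<nu>\<^sup>2 * I2 - C * exp (3 * (T + 1) powr \<nu>) * (L2norm (lebesgue_on \<Omega>) g)\<^sup>2
      - C * (L2norm (lebesgue_on \<Omega>) h)\<^sup>2 \<le> (LINT z|lebesgue_on ?Q. (Dt ?Q w z - Lop a ?Q w z)\<^sup>2 * ?e z)"
    using car w g h \<nu>(1) unfolding carleman_estimate_def I1_def I2_def by blast
  also have "\<dots> \<le> (LINT z|lebesgue_on ?Q. K * (((norm (grad_x ?Q w z))\<^sup>2 + (w z)\<^sup>2) * ?e z))"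
  proof (rule integral_mono_AE')
    show "integrable (lebesgue_on ?Q) (\<lambda>z. K * (((norm (grad_x ?Q w z))\<^sup>2 + (w z)\<^sup>2) * ?e z))"
      using int by simp
    show "AE z in lebesgue_on ?Q. (Dt ?Q w z - Lop a ?Q w z)\<^sup>2 * ?e z \<le>
        K * (((norm (grad_x ?Q w z))\<^sup>2 + (w z)\<^sup>2) * ?e z)"
      using ineq by eventually_elim (simp add: mult.assoc[symmetric])
    \<comment> \<open>The constant \<open>K\<close> may have any sign, but the right-hand side of the inequality dominates a square.\<close>
    show "AE z in lebesgue_on ?Q. 0 \<le> K * (((norm (grad_x ?Q w z))\<^sup>2 + (w z)\<^sup>2) * ?e z)"
      using ineq
    proof eventually_elim
      case (elim z)
      have "0 \<le> K * ((norm (grad_x ?Q w z))\<^sup>2 + (w z)\<^sup>2)"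
        using elim zero_le_power2 order_trans by blast
      then show ?case
        by (simp add: mult.assoc[symmetric])
    qed
  qed
  also have "\<dots> = K * I"
    by (simp add: I_def)
  finally have 1: "C * sqrt \<nu> * I1 + C * \<nu>\<^sup>2 * I2 - C * B \<le> K * I"
    by (simp add: B_def algebra_simps)
  have "sqrt \<nu> \<le> \<nu>\<^sup>2"
  proof -
    have "\<nu> \<le> (\<nu>\<^sup>2)\<^sup>2"
      using \<nu>(2) self_le_power[of \<nu> 4] by simp
    then show ?thesis
      by (simp add: real_le_lsqrt)
  qed
  then have "C * sqrt \<nu> * I2 \<le> C * \<nu>\<^sup>2 * I2"
    using C nonneg(1) by (intro mult_right_mono mult_left_mono) auto
  moreover have "2 * K * I \<le> C * sqrt \<nu> * I"
    using K nonneg(2) by (intro mult_right_mono)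
  ultimately have "C * (sqrt \<nu> * I) \<le> C * (2 * B)"
    using 1 by (simp add: I algebra_simps)
  with C show "sqrt \<nu> * I \<le> 2 * B"
    by (simp only: mult_le_cancel_left_pos)
qed

text \<open>On the left the gradient is the weak gradient on the short cylinder, which agrees almost
  everywhere with the one on the full cylinder.\<close>

lemma H10norm_subcylinder:
  fixes w :: "'n::finite spacetime \<Rightarrow> real"
  assumes \<Omega>: "open \<Omega>" and \<tau>: "0 < \<tau>" "\<tau> < T" and \<nu>: "\<nu> \<ge> 0"
    and w: "w \<in> sobolev_H (Suc k) (cyl \<Omega> 0 T)"
    and int: "integrable (lebesgue_on (cyl \<Omega> 0 T))
      (\<lambda>z. ((norm (grad_x (cyl \<Omega> 0 T) w z))\<^sup>2 + (w z)\<^sup>2) * exp (2 * (snd z + 1) powr \<nu>))"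
  shows "exp (2 * (\<tau> + 1) powr \<nu>) * (H10norm (cyl \<Omega> \<tau> T) w)\<^sup>2 \<le> (LINT z|lebesgue_on (cyl \<Omega> 0 T).
      ((norm (grad_x (cyl \<Omega> 0 T) w z))\<^sup>2 + (w z)\<^sup>2) * exp (2 * (snd z + 1) powr \<nu>))"
proof -
  let ?Q = "cyl \<Omega> 0 T" and ?R = "cyl \<Omega> \<tau> T"
  have Q: "open ?Q" "open ?R" by (rule open_cyl[OF \<Omega>])+
  have sub: "?R \<subseteq> ?Q"
    using \<tau> by (auto simp: cyl_def)
  have "(H10norm ?R w)\<^sup>2 = (LINT z|lebesgue_on ?R. (norm (grad_x ?R w z))\<^sup>2 + (w z)\<^sup>2)"
    by (simp add: H10norm_def)
  then have "exp (2 * (\<tau> + 1) powr \<nu>) * (H10norm ?R w)\<^sup>2 =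
      (LINT z|lebesgue_on ?R. exp (2 * (\<tau> + 1) powr \<nu>) * ((norm (grad_x ?R w z))\<^sup>2 + (w z)\<^sup>2))"
    by simp
  also have "\<dots> \<le> (LINT z|lebesgue_on ?Q. ((norm (grad_x ?Q w z))\<^sup>2 + (w z)\<^sup>2) * exp (2 * (snd z + 1) powr \<nu>))"
  proof (rule integral_mono_lebesgue_on_AE[OF int])
    have "AE z in lebesgue_on ?R. z \<in> ?R"
      using AE_space[of "lebesgue_on ?R"] by simp
    with grad_x_subset[OF Q sub w]
    show "AE z in lebesgue_on ?R. exp (2 * (\<tau> + 1) powr \<nu>) * ((norm (grad_x ?R w z))\<^sup>2 + (w z)\<^sup>2)
        \<le> ((norm (grad_x ?Q w z))\<^sup>2 + (w z)\<^sup>2) * exp (2 * (snd z + 1) powr \<nu>)"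
    proof eventually_elim
      case (elim z)
      then have "(\<tau> + 1) powr \<nu> \<le> (snd z + 1) powr \<nu>"
        using \<tau> \<nu> by (intro powr_mono2) (auto simp: cyl_def)
      then have "exp (2 * (\<tau> + 1) powr \<nu>) * ((norm (grad_x ?Q w z))\<^sup>2 + (w z)\<^sup>2)
          \<le> exp (2 * (snd z + 1) powr \<nu>) * ((norm (grad_x ?Q w z))\<^sup>2 + (w z)\<^sup>2)"
        by (intro mult_right_mono) auto
      then show ?case
        by (simp add: elim mult.commute)
    qed
  qed (use Q sub in auto)
  finally show ?thesis .
qed


section \<open>The choice of the Carleman parameter\<close>

text \<open>The parameter solves \<open>(T + 1)\<^sup>\<nu> = ln (1 / \<delta>) / 3\<close>. Any other base \<open>\<tau> + 1\<close> is the power of \<open>T + 1\<close> with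
  exponent \<open>ln (\<tau> + 1) / ln (T + 1)\<close>, which is where the exponent of the logarithm in the final estimate comes from.\<close>

lemma optimal_carleman_parameter:
  fixes \<delta> :: real
  assumes T: "T > 0" and \<delta>: "0 < \<delta>" "\<delta> < 1"
  defines "\<nu> \<equiv> ln (ln (1 / \<delta>) / 3) / ln (T + 1)"
  shows "exp (3 * (T + 1) powr \<nu>) = 1 / \<delta>"
    and "\<And>\<tau>. \<tau> > 0 \<Longrightarrow> (\<tau> + 1) powr \<nu> =
      1 / 3 powr (ln (\<tau> + 1) / ln (T + 1)) * ln (1 / \<delta>) powr (ln (\<tau> + 1) / ln (T + 1))"
proof -
  define L where "L = ln (1 / \<delta>) / 3"
  have L: "L > 0"
    using \<delta> by (simp add: L_def)
  have lnT: "ln (T + 1) > 0"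
    using T by simp
  have p: "(s + 1) powr \<nu> = L powr (ln (s + 1) / ln (T + 1))" if "s > 0" for s
    using that L by (simp add: \<nu>_def L_def powr_def mult.commute)
  show "exp (3 * (T + 1) powr \<nu>) = 1 / \<delta>"
  proof -
    have "3 * (T + 1) powr \<nu> = ln (1 / \<delta>)"
      using p[OF T] lnT L by (simp add: L_def)
    then show ?thesis
      using \<delta> by (simp only: exp_ln zero_less_divide_1_iff)
  qed
  show "(\<tau> + 1) powr \<nu> =
      1 / 3 powr (ln (\<tau> + 1) / ln (T + 1)) * ln (1 / \<delta>) powr (ln (\<tau> + 1) / ln (T + 1))" if "\<tau> > 0" for \<tau>
    using p[OF that] \<delta> by (simp add: L_def powr_divide)
qed

text \<open>Smaller data errors permit larger parameters, so a condition on the threshold \<open>\<delta>0\<close> passes to all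
  smaller \<open>\<delta>\<close>. The left-hand side is the same expression in \<open>\<delta>0\<close>, written with powers.\<close>

lemma carleman_parameter_antimono:
  fixes \<delta> \<delta>0 :: real
  assumes T: "T > 0" and \<delta>: "0 < \<delta>" "\<delta> < \<delta>0" "\<delta>0 < 1"
  shows "ln ((ln (\<delta>0 powr (-1/3))) powr (1 / ln (T + 1))) \<le> ln (ln (1 / \<delta>) / 3) / ln (T + 1)"
proof -
  have lnT: "ln (T + 1) > 0"
    using T by simp
  have eq: "ln (\<delta>0 powr (-1/3)) = ln (1 / \<delta>0) / 3"
    using \<delta> by (simp add: ln_powr ln_div)
  have pos: "0 < ln (1 / \<delta>0) / 3"
    using \<delta> by simp
  have "ln ((ln (\<delta>0 powr (-1/3))) powr (1 / ln (T + 1))) = ln (ln (1 / \<delta>0) / 3) / ln (T + 1)"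
    unfolding eq using pos by (simp add: ln_powr)
  also have "\<dots> \<le> ln (ln (1 / \<delta>) / 3) / ln (T + 1)"
  proof (rule divide_right_mono)
    have "ln (1 / \<delta>0) \<le> ln (1 / \<delta>)"
      using \<delta> by (intro ln_mono) (auto simp: field_simps)
    then show "ln (ln (1 / \<delta>0) / 3) \<le> ln (ln (1 / \<delta>) / 3)"
      using pos by (intro ln_mono) auto
  qed (use lnT in simp)
  finally show ?thesis .
qed


section \<open>The stability estimate\<close>

theorem theorem3p1:
  fixes \<Omega> :: "(real^'n::finite) set" and T \<mu>1 \<mu>2 A Cbar \<nu>0 :: real
  assumes "open \<Omega>" "connected \<Omega>" "\<Omega> \<noteq> {}" "bounded \<Omega>" "piecewise_smooth_boundary \<Omega>"
    and "T > 0" and "0 < \<mu>1" "\<mu>1 \<le> \<mu>2" and "Cbar > 0"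
    and "\<nu>0 > 1"
    and "\<exists>C>0. \<forall>a. coefficients \<Omega> T \<mu>1 \<mu>2 A a \<longrightarrow> carleman_estimate \<Omega> T a \<nu>0 C"
  shows "\<exists>C1>0. \<exists>\<nu>1\<ge>\<nu>0.
    \<forall>(a :: 'n \<Rightarrow> 'n \<Rightarrow> (real^'n) \<times> real \<Rightarrow> real)
     (F :: (real^'n) \<times> real \<times> (real^'n) \<times> real \<Rightarrow> real)
     (\<delta>0 :: real) (\<delta> :: real) (M :: real) u1 u2 g1 g2 h1 h2.
      coefficients \<Omega> T \<mu>1 \<mu>2 A a \<and> Ck 1 F \<and> Cbar-lipschitz_on UNIV F \<and>
      0 < \<delta>0 \<and> \<delta>0 < 1 \<and> ln ((ln (\<delta>0 powr (-1/3))) powr (1 / ln (T + 1))) \<ge> \<nu>1 \<and>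
      0 < \<delta> \<and> \<delta> < \<delta>0 \<and> M > 0 \<and>
      solves_terminal_problem \<Omega> T a F g1 u1 \<and>
      solves_terminal_problem \<Omega> T a F g2 u2 \<and>
      L2norm (lebesgue_on \<Omega>) (\<lambda>x. g1 x - g2 x) \<le> \<delta> \<and>
      grad_trace_at \<Omega> T 0 u1 h1 \<and> L2norm (lebesgue_on \<Omega>) h1 \<le> M \<and>
      grad_trace_at \<Omega> T 0 u2 h2 \<and> L2norm (lebesgue_on \<Omega>) h2 \<le> M
      \<longrightarrow> (\<forall>\<tau>. 0 < \<tau> \<and> \<tau> < T \<longrightarrow>
            (let c = ln (\<tau> + 1) / ln (T + 1) in
               0 < c \<and> c < 1 \<and>
               H10norm (cyl \<Omega> \<tau> T) (\<lambda>z. u1 z - u2 z)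
                 \<le> C1 * (M + 1) * exp (- (1 / 3 powr c) * (ln (1 / \<delta>)) powr c)))"
proof -
  obtain C where C: "C > 0" "\<And>a. coefficients \<Omega> T \<mu>1 \<mu>2 A a \<Longrightarrow> carleman_estimate \<Omega> T a \<nu>0 C"
    using assms(11) by blast
  \<comment> \<open>The second entry makes \<open>C sqrt \<nu>\<close> dominate \<open>2 Cbar\<^sup>2\<close>; the first also gives \<open>\<nu> \<ge> 1\<close>.\<close>
  define \<nu>1 where "\<nu>1 = max \<nu>0 ((2 * Cbar\<^sup>2 / C)\<^sup>2)"
  show ?thesis
  proof (rule exI[of _ 3], intro conjI, simp, rule exI[of _ \<nu>1], intro conjI allI impI; (elim conjE)?)
    show "\<nu>1 \<ge> \<nu>0"
      by (simp add: \<nu>1_def)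
  next
    fix a :: "'n \<Rightarrow> 'n \<Rightarrow> (real^'n) \<times> real \<Rightarrow> real" and F \<delta>0 \<delta> M u1 u2 g1 g2 h1 h2 \<tau>
    assume a: "coefficients \<Omega> T \<mu>1 \<mu>2 A a"
      and F: "Cbar-lipschitz_on UNIV F"
      and \<delta>0: "0 < \<delta>0" "\<delta>0 < 1" "ln ((ln (\<delta>0 powr (-1/3))) powr (1 / ln (T + 1))) \<ge> \<nu>1"
      and \<delta>: "0 < \<delta>" "\<delta> < \<delta>0" and M: "M > 0"
      and s1: "solves_terminal_problem \<Omega> T a F g1 u1" and s2: "solves_terminal_problem \<Omega> T a F g2 u2"
      and g: "L2norm (lebesgue_on \<Omega>) (\<lambda>x. g1 x - g2 x) \<le> \<delta>"
      and h1: "grad_trace_at \<Omega> T 0 u1 h1" "L2norm (lebesgue_on \<Omega>) h1 \<le> M"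
      and h2: "grad_trace_at \<Omega> T 0 u2 h2" "L2norm (lebesgue_on \<Omega>) h2 \<le> M"
      and \<tau>: "0 < \<tau>" "\<tau> < T"
    define \<nu> where "\<nu> = ln (ln (1 / \<delta>) / 3) / ln (T + 1)"
    define c where "c = ln (\<tau> + 1) / ln (T + 1)"
    define y where "y = 1 / 3 powr c * ln (1 / \<delta>) powr c"
    define w where "w = (\<lambda>z. u1 z - u2 z)"
    let ?Q = "cyl \<Omega> 0 T"
    have c: "0 < c" "c < 1"
      using \<tau> by (auto simp: c_def)
    have \<delta>1: "\<delta> < 1"
      using \<delta> \<delta>0 by simp
    note par = optimal_carleman_parameter[OF \<open>T > 0\<close> \<open>0 < \<delta>\<close> \<delta>1, folded \<nu>_def]
    have "\<nu>1 \<le> \<nu>"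
      using carleman_parameter_antimono[OF \<open>T > 0\<close> \<delta> \<delta>0(2)] \<delta>0(3) by (simp add: \<nu>_def)
    then have \<nu>: "\<nu> \<ge> \<nu>0" "\<nu> \<ge> 1" "(2 * Cbar\<^sup>2 / C)\<^sup>2 \<le> \<nu>"
      using \<open>\<nu>0 > 1\<close> by (auto simp: \<nu>1_def)
    have "2 * Cbar\<^sup>2 / C \<le> sqrt \<nu>"
      using \<nu>(3) by (rule real_le_rsqrt)
    then have K: "2 * Cbar\<^sup>2 \<le> C * sqrt \<nu>"
      using C(1) by (simp add: field_simps)
    note w = solution_difference[OF \<open>open \<Omega>\<close> \<open>T > 0\<close> w_def F s1 s2]
    have u: "u1 \<in> sobolev_H (Suc (Suc 0)) ?Q" "u2 \<in> sobolev_H (Suc (Suc 0)) ?Q"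
      using s1 s2 unfolding solves_terminal_problem_def numeral_2_eq_2 by blast+
    have h: "grad_trace_at \<Omega> T 0 w (\<lambda>x. h1 x - h2 x)"
      unfolding w_def by (rule grad_trace_at_diff[OF \<open>open \<Omega>\<close> \<open>T > 0\<close> _ u h1(1) h2(1)]) (use \<open>T > 0\<close> in simp)
    note energy = weighted_energy_bound[OF \<open>open \<Omega>\<close> \<open>T > 0\<close> C(2)[OF a] C(1) \<nu>(1,2) K w(1,2,3) h w(4)]
    let ?I = "LINT z|lebesgue_on ?Q. ((norm (grad_x ?Q w z))\<^sup>2 + (w z)\<^sup>2) * exp (2 * (snd z + 1) powr \<nu>)"
    have "exp (2 * y) * (H10norm (cyl \<Omega> \<tau> T) w)\<^sup>2 \<le> ?I"
      using H10norm_subcylinder[OF \<open>open \<Omega>\<close> \<tau> _ w(1)[unfolded numeral_2_eq_2] energy(2)] \<nu>(2)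
        par(2)[OF \<tau>(1)] by (simp add: y_def c_def)
    also have "?I \<le> sqrt \<nu> * ?I"
    proof -
      have "0 \<le> ?I" by (rule Bochner_Integration.integral_nonneg) simp
      then show ?thesis
        using mult_right_mono[of 1 "sqrt \<nu>" ?I] \<nu>(2) by simp
    qed
    also have "\<dots> \<le> 2 * (exp (3 * (T + 1) powr \<nu>) * (L2norm (lebesgue_on \<Omega>) (\<lambda>x. g1 x - g2 x))\<^sup>2 +
        (L2norm (lebesgue_on \<Omega>) (\<lambda>x. h1 x - h2 x))\<^sup>2)"
      by (rule energy(1))
    also have "\<dots> \<le> 2 * (1 + 4 * M\<^sup>2)"
    proof -
      have "(L2norm (lebesgue_on \<Omega>) (\<lambda>x. g1 x - g2 x))\<^sup>2 \<le> \<delta>\<^sup>2"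
        using g by (intro power_mono) (auto simp: L2norm_def)
      then have "exp (3 * (T + 1) powr \<nu>) * (L2norm (lebesgue_on \<Omega>) (\<lambda>x. g1 x - g2 x))\<^sup>2 \<le> 1 / \<delta> * \<delta>\<^sup>2"
        unfolding par(1) using \<delta>(1) by (intro mult_left_mono) auto
      moreover have "1 / \<delta> * \<delta>\<^sup>2 \<le> 1"
        using \<delta>(1) \<delta>1 by (simp add: power2_eq_square)
      moreover have "(L2norm (lebesgue_on \<Omega>) (\<lambda>x. h1 x - h2 x))\<^sup>2 \<le> 4 * M\<^sup>2"
        using h1 h2 by (intro L2norm_diff_le) (auto simp: grad_trace_at_def trace_at_def has_trace_def)
      ultimately show ?thesis by simp
    qed
    \<comment> \<open>This is where the constant 3 comes from: \<open>2 + 8 M\<^sup>2 \<le> 9 (M + 1)\<^sup>2\<close>.\<close>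
    also have "\<dots> \<le> (3 * (M + 1))\<^sup>2"
      using M by (simp add: power2_eq_square algebra_simps)
    finally have "(exp y * H10norm (cyl \<Omega> \<tau> T) w)\<^sup>2 \<le> (3 * (M + 1))\<^sup>2"
      by (simp add: power_mult_distrib exp_double)
    then have "exp y * H10norm (cyl \<Omega> \<tau> T) w \<le> 3 * (M + 1)"
      by (rule power2_le_imp_le) (use M in simp)
    then have "H10norm (cyl \<Omega> \<tau> T) w \<le> 3 * (M + 1) * exp (- y)"
      by (simp add: exp_minus field_simps)
    with c show "let c = ln (\<tau> + 1) / ln (T + 1) in
        0 < c \<and> c < 1 \<and>
        H10norm (cyl \<Omega> \<tau> T) (\<lambda>z. u1 z - u2 z)
          \<le> 3 * (M + 1) * exp (- (1 / 3 powr c) * (ln (1 / \<delta>)) powr c)"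
      by (simp add: Let_def c_def[symmetric] w_def y_def)
  qed
qed

end
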